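(* Let $\omega$ be a clustering state. There exists a bijection $\mathfrak D:\mathcal Q_\omega\to\mathcal H_\omega$ such that for every $Q_\omega\in\mathcal Q_\omega$ and every $A\in\mathcal O$, $$Q_\omega(A)=\langle\mathfrak D(Q_\omega),A\rangle_\omega.$$ In particular, every $Q_\omega\in\mathcal Q_\omega$ extends to a continuous linear functional on $\mathcal H_\omega$.
   Context: Setting: Fix $D\ge1$, $\mathbb Z^D$ with $\mathrm{dist}(x,y)=\sum_i|x_i-y_i|$, $\mathtt B(n)=\{x:\mathrm{dist}(x,0)\le n\}$. $\mathcal O$ is a complex normed space with distinguished $\mathbf 1$ of norm 1, finite-dimensional subspaces $\mathcal O_X$ ($X$ finite) with $\mathcal O_\emptyset=\mathbb C\mathbf 1$, $X\subset Y\Rightarrow\mathcal O_X\subset\mathcal O_Y$, $\mathcal O_X\cap\mathcal O_Y=\mathcal O_{X\cap Y}$, $\mathcal O=\bigcup_X\mathcal O_X$; $\mathrm{supp}(A)$ smallest $X$ with $A\in\mathcal O_X$, $|A|=|\mathrm{supp}A|$, $\mathrm{dist}(A,B)$ distance of supports ($\mathrm{dist}(A,\mathbf 1)=\infty$). Completion $\mathcal A$ is a unital $C^*$-algebra, $\mathcal O_X$ are $C^*$-subalgebras, disjointly supported elements commute and their product has union support; translations $\iota_x$ are $*$-automorphisms, $\iota_x\iota_y=\iota_{x+y}$, $\mathrm{supp}(\iota_xA)=\mathrm{supp}(A)+x$. A clustering state is a translation-invariant state $\omega$ on $\mathcal A$ for which there exist $\nu:\mathbb N\to\mathbb R^+$,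 $f:\mathbb Z\to\mathbb R^+$, $p>D$ with $f(d)\le d^{-p}$ ($d>0$) and $|\omega(AB)-\omega(A)\omega(B)|\le\nu(\ell)\|A\|\|B\|f(\mathrm{dist}(A,B))$ whenever $|A|,|B|<\ell$. $\langle A,B\rangle_\omega:=\sum_{x\in\mathbb Z^D}(\omega(\iota_x(A)^*B)-\omega(A^* )\omega(B))$ (positive semi-definite); $\mathcal H_\omega$ is the Cauchy completion of $\mathcal O$ modulo its null space, elements of $\mathcal O$ identified with their classes. Pseudolocal sequences: $Q=(Q_n)_{n\in\mathbb N}$ with $Q_n\in\mathcal O_{\mathtt B(n)}$ is pseudolocal w.r.t. $\omega$ if $Q'_n:=Q_n-\omega(Q_n)\mathbf 1$ satisfies: (I) there is $\gamma>0$ with $\omega(Q_n'^*Q'_n)\le\gamma n^D$ for all $n>0$; (II) for every $A\in\mathcal O$ the limit $Q_\omega(A):=\lim_{n\to\infty}\omega(Q_n'^*A)$ exists in $\mathbb C$; (III) there is $0<k<1$ such that for every $A\in\mathcal O$, $\lim_{n\to\infty}\max_{x,y\in\mathtt B(kn)}|\omega(Q_n'^*\iota_x(A))-\omega(Q_n'^*\iota_y(A))|=0$. The functional $Q_\omega$ on $\mathcal O$ is the left pseudolocal charge of $Q$, and $\mathcal Q_\omega$ denotes the set of all left pseudolocal charges w.r.t. $\omega$. *)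

theory Defs
  imports "HOL-Analysis.Analysis"
begin

text \<open>
Abstract setting.  The quasi-local C*-algebra (the completion of the local algebra) is
modelled by a type 'a of class real_normed_algebra_1 and banach, equipped with a complex
scalar multiplication sc (compatible with the real one, with the norm and with the product)
and an involution st satisfying the C*-identity.  Lattice sites are int ^ 'd, so D = CARD('d).
Oloc X is the local algebra of a finite region X, iota the translations, om the state.
\<close>

definition ldist :: "int ^ 'd \<Rightarrow> int ^ 'd \<Rightarrow> int" where
  "ldist x y = (\<Sum>i\<in>UNIV. \<bar>x $ i - y $ i\<bar>)"

definition lball :: "real \<Rightarrow> (int ^ 'd) set" where
  "lball r = {x. real_of_int (ldist x 0) \<le> r}"

definition cstar_algebra :: "(complex \<Rightarrow> 'a \<Rightarrow> 'a) \<Rightarrow> ('a::{real_normed_algebra_1,banach} \<Rightarrow> 'a) \<Rightarrow> bool" where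
  "cstar_algebra sc st \<longleftrightarrow>
     vector_space sc
   \<and> (\<forall>r A. sc (complex_of_real r) A = scaleR r A)
   \<and> (\<forall>c A. norm (sc c A) = cmod c * norm A)
   \<and> (\<forall>c A B. sc c (A * B) = sc c A * B \<and> sc c (A * B) = A * sc c B)
   \<and> (\<forall>A. st (st A) = A)
   \<and> (\<forall>A B. st (A + B) = st A + st B)
   \<and> (\<forall>c A. st (sc c A) = sc (cnj c) (st A))
   \<and> (\<forall>A B. st (A * B) = st B * st A)
   \<and> (\<forall>A. norm (st A * A) = (norm A)\<^sup>2)"

definition Obs :: "((int ^ 'd) set \<Rightarrow> 'a set) \<Rightarrow> 'a set" where
  "Obs Oloc = \<Union>{Oloc X | X. finite X}"

text \<open>Support: the smallest finite region whose local algebra contains A (for A in Obs).\<close>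
definition supp :: "((int ^ 'd) set \<Rightarrow> 'a set) \<Rightarrow> 'a \<Rightarrow> (int ^ 'd) set" where
  "supp Oloc A = \<Inter>{X. finite X \<and> A \<in> Oloc X}"

text \<open>Distance of supports (only used when both supports are nonempty).\<close>
definition distO :: "((int ^ 'd) set \<Rightarrow> 'a set) \<Rightarrow> 'a \<Rightarrow> 'a \<Rightarrow> int" where
  "distO Oloc A B = Min {ldist x y | x y. x \<in> supp Oloc A \<and> y \<in> supp Oloc B}"

definition star_automorphism ::
  "(complex \<Rightarrow> 'a \<Rightarrow> 'a) \<Rightarrow> ('a \<Rightarrow> 'a) \<Rightarrow> ('a::{real_normed_algebra_1} \<Rightarrow> 'a) \<Rightarrow> bool" where
  "star_automorphism sc st \<phi> \<longleftrightarrow>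
     bij \<phi>
   \<and> (\<forall>A B. \<phi> (A + B) = \<phi> A + \<phi> B)
   \<and> (\<forall>c A. \<phi> (sc c A) = sc c (\<phi> A))
   \<and> (\<forall>A B. \<phi> (A * B) = \<phi> A * \<phi> B)
   \<and> \<phi> 1 = 1
   \<and> (\<forall>A. \<phi> (st A) = st (\<phi> A))"

definition quasi_local ::
  "(complex \<Rightarrow> 'a \<Rightarrow> 'a) \<Rightarrow> ('a::{real_normed_algebra_1,banach} \<Rightarrow> 'a) \<Rightarrow> ((int ^ 'd) set \<Rightarrow> 'a set)
    \<Rightarrow> (int ^ 'd \<Rightarrow> 'a \<Rightarrow> 'a) \<Rightarrow> bool" where
  "quasi_local sc st Oloc iota \<longleftrightarrow>
     cstar_algebra sc st
   \<comment> \<open>local algebras: finite-dimensional C*-subalgebras (unital, closed under product and star)\<close>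
   \<and> (\<forall>X. finite X \<longrightarrow>
        module.subspace sc (Oloc X)
      \<and> (\<exists>B. finite B \<and> B \<subseteq> Oloc X \<and> module.span sc B = Oloc X)
      \<and> 1 \<in> Oloc X
      \<and> (\<forall>A\<in>Oloc X. \<forall>B\<in>Oloc X. A * B \<in> Oloc X)
      \<and> (\<forall>A\<in>Oloc X. st A \<in> Oloc X))
   \<and> Oloc {} = range (\<lambda>c. sc c 1)
   \<and> (\<forall>X Y. finite X \<longrightarrow> finite Y \<longrightarrow> X \<subseteq> Y \<longrightarrow> Oloc X \<subseteq> Oloc Y)
   \<and> (\<forall>X Y. finite X \<longrightarrow> finite Y \<longrightarrow> Oloc X \<inter> Oloc Y = Oloc (X \<inter> Y))
   \<comment> \<open>the algebra is the completion of the local observables\<close>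
   \<and> closure (Obs Oloc) = UNIV
   \<comment> \<open>disjointly supported (nonzero) local elements commute, product has union support\<close>
   \<and> (\<forall>A\<in>Obs Oloc. \<forall>B\<in>Obs Oloc. A \<noteq> 0 \<longrightarrow> B \<noteq> 0 \<longrightarrow>
        supp Oloc A \<inter> supp Oloc B = {} \<longrightarrow>
        A * B = B * A \<and> supp Oloc (A * B) = supp Oloc A \<union> supp Oloc B)
   \<comment> \<open>translations\<close>
   \<and> (\<forall>x. star_automorphism sc st (iota x))
   \<and> (\<forall>x y. iota x \<circ> iota y = iota (x + y))
   \<and> (\<forall>x. \<forall>A\<in>Obs Oloc. iota x A \<in> Obs Oloc \<and>
          supp Oloc (iota x A) = (\<lambda>y. y + x) ` supp Oloc A)"

definition is_state :: "(complex \<Rightarrow> 'a \<Rightarrow> 'a) \<Rightarrow> ('a \<Rightarrow> 'a) \<Rightarrow> ('a::real_normed_algebra_1 \<Rightarrow> complex) \<Rightarrow> bool" where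
  "is_state sc st om \<longleftrightarrow>
     (\<forall>A B. om (A + B) = om A + om B)
   \<and> (\<forall>c A. om (sc c A) = c * om A)
   \<and> (\<forall>A. Im (om (st A * A)) = 0 \<and> Re (om (st A * A)) \<ge> 0)
   \<and> om 1 = 1"

definition clustering_state ::
  "(complex \<Rightarrow> 'a \<Rightarrow> 'a) \<Rightarrow> ('a \<Rightarrow> 'a) \<Rightarrow> ((int ^ 'd) set \<Rightarrow> 'a set)
    \<Rightarrow> (int ^ 'd \<Rightarrow> 'a \<Rightarrow> 'a) \<Rightarrow> ('a::real_normed_algebra_1 \<Rightarrow> complex) \<Rightarrow> bool" where
  "clustering_state sc st Oloc iota om \<longleftrightarrow>
     is_state sc st om
   \<and> (\<forall>x A. om (iota x A) = om A)
   \<and> (\<exists>(\<nu>::nat \<Rightarrow> real) (f::int \<Rightarrow> real) (p::real).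
        (\<forall>l. \<nu> l > 0) \<and> (\<forall>d. f d > 0) \<and> p > real CARD('d)
      \<and> (\<forall>d>0. f d \<le> real_of_int d powr (- p))
      \<and> (\<forall>l A B. A \<in> Obs Oloc \<longrightarrow> B \<in> Obs Oloc \<longrightarrow>
            card (supp Oloc A) < l \<longrightarrow> card (supp Oloc B) < l \<longrightarrow>
            supp Oloc A \<noteq> {} \<longrightarrow> supp Oloc B \<noteq> {} \<longrightarrow>
            cmod (om (A * B) - om A * om B)
              \<le> \<nu> l * norm A * norm B * f (distO Oloc A B)))"

definition ipw :: "('a \<Rightarrow> 'a) \<Rightarrow> (int ^ 'd \<Rightarrow> 'a \<Rightarrow> 'a) \<Rightarrow> ('a::real_normed_algebra_1 \<Rightarrow> complex)
    \<Rightarrow> 'a \<Rightarrow> 'a \<Rightarrow> complex" where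
  "ipw st iota om A B = infsum (\<lambda>x. om (st (iota x A) * B) - om (st A) * om B) UNIV"

text \<open>Cauchy completion of the local observables modulo the null space:
  classes of seminorm-Cauchy sequences in Obs.\<close>
definition hcauchy :: "((int ^ 'd) set \<Rightarrow> 'a set) \<Rightarrow> ('a \<Rightarrow> 'a) \<Rightarrow> (int ^ 'd \<Rightarrow> 'a \<Rightarrow> 'a)
    \<Rightarrow> ('a::real_normed_algebra_1 \<Rightarrow> complex) \<Rightarrow> (nat \<Rightarrow> 'a) \<Rightarrow> bool" where
  "hcauchy Oloc st iota om s \<longleftrightarrow>
     (\<forall>n. s n \<in> Obs Oloc)
   \<and> (\<forall>e>0. \<exists>N. \<forall>m\<ge>N. \<forall>n\<ge>N. cmod (ipw st iota om (s m - s n) (s m - s n)) < e)"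

definition hrel :: "((int ^ 'd) set \<Rightarrow> 'a set) \<Rightarrow> ('a \<Rightarrow> 'a) \<Rightarrow> (int ^ 'd \<Rightarrow> 'a \<Rightarrow> 'a)
    \<Rightarrow> ('a::real_normed_algebra_1 \<Rightarrow> complex) \<Rightarrow> ((nat \<Rightarrow> 'a) \<times> (nat \<Rightarrow> 'a)) set" where
  "hrel Oloc st iota om = {(s, t). hcauchy Oloc st iota om s \<and> hcauchy Oloc st iota om t
      \<and> (\<lambda>n. ipw st iota om (s n - t n) (s n - t n)) \<longlonglongrightarrow> 0}"

definition Hspace :: "((int ^ 'd) set \<Rightarrow> 'a set) \<Rightarrow> ('a \<Rightarrow> 'a) \<Rightarrow> (int ^ 'd \<Rightarrow> 'a \<Rightarrow> 'a)
    \<Rightarrow> ('a::real_normed_algebra_1 \<Rightarrow> complex) \<Rightarrow> (nat \<Rightarrow> 'a) set set" where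
  "Hspace Oloc st iota om = {s. hcauchy Oloc st iota om s} // hrel Oloc st iota om"

text \<open>Inner product of a vector of the completion with a local observable
  (the latter identified with its class).\<close>
definition Hip :: "('a \<Rightarrow> 'a) \<Rightarrow> (int ^ 'd \<Rightarrow> 'a \<Rightarrow> 'a) \<Rightarrow> ('a::real_normed_algebra_1 \<Rightarrow> complex)
    \<Rightarrow> (nat \<Rightarrow> 'a) set \<Rightarrow> 'a \<Rightarrow> complex" where
  "Hip st iota om h A = lim (\<lambda>n. ipw st iota om ((SOME s. s \<in> h) n) A)"

definition centred :: "(complex \<Rightarrow> 'a \<Rightarrow> 'a) \<Rightarrow> ('a::real_normed_algebra_1 \<Rightarrow> complex)
    \<Rightarrow> (nat \<Rightarrow> 'a) \<Rightarrow> nat \<Rightarrow> 'a" where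
  "centred sc om Q n = Q n - sc (om (Q n)) 1"

definition pseudolocal ::
  "(complex \<Rightarrow> 'a \<Rightarrow> 'a) \<Rightarrow> ('a \<Rightarrow> 'a) \<Rightarrow> ((int ^ 'd) set \<Rightarrow> 'a set)
    \<Rightarrow> (int ^ 'd \<Rightarrow> 'a \<Rightarrow> 'a) \<Rightarrow> ('a::real_normed_algebra_1 \<Rightarrow> complex) \<Rightarrow> (nat \<Rightarrow> 'a) \<Rightarrow> bool" where
  "pseudolocal sc st Oloc iota om Q \<longleftrightarrow>
     (\<forall>n. Q n \<in> Oloc (lball (real n) :: (int ^ 'd) set))
   \<and> (\<exists>\<gamma>>0. \<forall>n>0. Re (om (st (centred sc om Q n) * centred sc om Q n))
                      \<le> \<gamma> * real n ^ CARD('d))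
   \<and> (\<forall>A\<in>Obs Oloc. convergent (\<lambda>n. om (st (centred sc om Q n) * A)))
   \<and> (\<exists>k. 0 < k \<and> k < 1 \<and> (\<forall>A\<in>Obs Oloc.
        (\<lambda>n. Max ((\<lambda>(x, y). cmod (om (st (centred sc om Q n) * iota x A)
                                   - om (st (centred sc om Q n) * iota y A)))
                 ` (lball (k * real n) \<times> lball (k * real n)))) \<longlonglongrightarrow> 0))"

definition left_charge ::
  "(complex \<Rightarrow> 'a \<Rightarrow> 'a) \<Rightarrow> ('a \<Rightarrow> 'a) \<Rightarrow> ((int ^ 'd) set \<Rightarrow> 'a set)
    \<Rightarrow> ('a::real_normed_algebra_1 \<Rightarrow> complex) \<Rightarrow> (nat \<Rightarrow> 'a) \<Rightarrow> 'a \<Rightarrow> complex" where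
  "left_charge sc st Oloc om Q A =
     (if A \<in> Obs Oloc then lim (\<lambda>n. om (st (centred sc om Q n) * A)) else 0)"

definition charges ::
  "(complex \<Rightarrow> 'a \<Rightarrow> 'a) \<Rightarrow> ('a \<Rightarrow> 'a) \<Rightarrow> ((int ^ 'd) set \<Rightarrow> 'a set)
    \<Rightarrow> (int ^ 'd \<Rightarrow> 'a \<Rightarrow> 'a) \<Rightarrow> ('a::real_normed_algebra_1 \<Rightarrow> complex) \<Rightarrow> ('a \<Rightarrow> complex) set" where
  "charges sc st Oloc iota om =
     {left_charge sc st Oloc om Q | Q. pseudolocal sc st Oloc iota om Q}"

end

theory Submission
  imports Defs
begin

text \<open>
  Clustering makes \<open>\<langle>A, B\<rangle>\<^sub>\<omega>\<close> an absolutely convergent sum, equal to the limit of the covariance density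
  of the block sums \<open>\<Sum>\<^sub>x \<iota>\<^sub>x A\<close> and \<open>\<Sum>\<^sub>x \<iota>\<^sub>x B\<close> over growing cubes; in particular it is positive.

  If \<open>Q\<close> is pseudolocal, condition (III) allows \<open>A\<close> in \<open>\<omega>(Q'\<^sub>n\<^sup>* A)\<close> to be replaced by its average over
  a cube of side proportional to \<open>n\<close>. Cauchy--Schwarz, condition (I) and the covariance density of block
  sums bound the limit by a multiple of \<open>\<parallel>A\<parallel>\<^sub>\<omega>\<close>, so Riesz representation yields the vector \<open>\<DD>(Q\<^sub>\<omega>)\<close>,
  which is unique because \<open>\<O>\<close> is dense.
  Conversely, a vector represented by a Cauchy sequence \<open>s\<^sub>j\<close> is the charge of the block sums of
  \<open>s\<^bsub>j(n)\<^esub>\<close> over cubes of side proportional to \<open>n\<close>, where \<open>j(n)\<close> tends to infinity slowly enough.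
\<close>

section \<open>Positive semidefinite forms\<close>

text \<open>Conditions (II) and (III) quantify over all observables, but in the converse direction
  the index j(n) is fixed before the observable is known. The clustering estimate is therefore
  needed with a constant that depends only on the first observable and on a radius, and linearly on
  the norm of the second one; calibrating the j-th constant to radius j eventually covers every
  local observable. Such an estimate at translated observables needs a norm bound for
  \<open>iota x\<close>, while translations are given only as algebraic automorphisms; finite
  dimension of the local algebras supplies it. Clustering decays in the l1 distance with exponent p
  > D. The decay is dominated by a product of one-dimensional weights of exponent p / D > 1, and
  balls are traded for cubes, so that summability and counting factor over the coordinates. The map
  is built from vectors to charges and inverted at the end. Surjectivity is Riesz representation;
  injectivity says that a Cauchy sequence whose products with every local observable tend to 0 is
  itself null.\<close>

locale positive_form = vector_space sc
  for sc :: "complex \<Rightarrow> 'a::ab_group_add \<Rightarrow> 'a" +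
  fixes S :: "'a set" and F :: "'a \<Rightarrow> 'a \<Rightarrow> complex"
  assumes S_add: "x \<in> S \<Longrightarrow> y \<in> S \<Longrightarrow> x + y \<in> S"
    and S_sc: "x \<in> S \<Longrightarrow> sc c x \<in> S"
    and S_zero: "0 \<in> S"
    and F_add: "x \<in> S \<Longrightarrow> y \<in> S \<Longrightarrow> z \<in> S \<Longrightarrow> F x (y + z) = F x y + F x z"
    and F_sc: "x \<in> S \<Longrightarrow> y \<in> S \<Longrightarrow> F x (sc c y) = c * F x y"
    and F_herm: "x \<in> S \<Longrightarrow> y \<in> S \<Longrightarrow> F y x = cnj (F x y)"
    and F_pos: "x \<in> S \<Longrightarrow> 0 \<le> Re (F x x)"
begin

text \<open>Only a seminorm, since null vectors are allowed. For the GNS form it gives the standard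
  deviation of a centred element, for \<open>ipw\<close> the norm of the completion.\<close>

definition sn :: "'a \<Rightarrow> real" where "sn x = sqrt (Re (F x x))"

lemma S_diff: "x \<in> S \<Longrightarrow> y \<in> S \<Longrightarrow> x - y \<in> S"
  using S_add[of x "sc (-1) y"] S_sc[of y "-1"] by simp

lemma F_add_left: "x \<in> S \<Longrightarrow> y \<in> S \<Longrightarrow> z \<in> S \<Longrightarrow> F (x + y) z = F x z + F y z"
  by (metis F_add F_herm S_add complex_cnj_add)

lemma F_sc_left: "x \<in> S \<Longrightarrow> y \<in> S \<Longrightarrow> F (sc c x) y = cnj c * F x y"
  by (metis F_herm F_sc S_sc complex_cnj_mult)

lemma F_diff: "x \<in> S \<Longrightarrow> y \<in> S \<Longrightarrow> z \<in> S \<Longrightarrow> F x (y - z) = F x y - F x z"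
  by (metis F_add S_diff add_diff_cancel_right' diff_add_cancel)

lemma F_diff_left: "x \<in> S \<Longrightarrow> y \<in> S \<Longrightarrow> z \<in> S \<Longrightarrow> F (x - y) z = F x z - F y z"
  by (metis F_add_left S_diff add_diff_cancel_right' diff_add_cancel)

lemma F_self: "x \<in> S \<Longrightarrow> F x x = complex_of_real (Re (F x x))"
  using F_herm[of x x] by (simp add: complex_eq_iff)

lemma cmod_F_self: "x \<in> S \<Longrightarrow> cmod (F x x) = Re (F x x)"
  by (metis F_self F_pos norm_of_real abs_of_nonneg)

lemma sn_nonneg: "x \<in> S \<Longrightarrow> 0 \<le> sn x"
  by (simp add: sn_def F_pos)

lemma sn_sq: "x \<in> S \<Longrightarrow> (sn x)\<^sup>2 = Re (F x x)"
  by (simp add: sn_def F_pos)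

text \<open>The common source of the Cauchy-Schwarz and triangle inequalities, of the parallelogram
  law (t = 1 and t = -1) and of the first variation in the Riesz argument.\<close>

lemma F_expand:
  assumes "x \<in> S" "y \<in> S"
  shows "Re (F (x + sc t y) (x + sc t y)) = Re (F x x) + 2 * Re (t * F x y) + (cmod t)\<^sup>2 * Re (F y y)"
proof -
  have "F (x + sc t y) (x + sc t y) = F x x + t * F x y + (cnj t * F y x + cnj t * (t * F y y))"
    using assms by (simp add: F_add F_add_left F_sc F_sc_left S_add S_sc algebra_simps)
  also have "cnj t * F y x = cnj (t * F x y)"
    using F_herm[OF assms] by simp
  also have "cnj t * (t * F y y) = complex_of_real ((cmod t)\<^sup>2 * Re (F y y))"
    using F_self[OF assms(2)]
    by (metis complex_norm_square mult.assoc mult.commute of_real_mult)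
  finally show ?thesis by simp
qed

lemma Cauchy_Schwarz:
  assumes "x \<in> S" "y \<in> S"
  shows "cmod (F x y) \<le> sn x * sn y"
proof -
  define a b d where "a = Re (F x x)" and "b = Re (F y y)" and "d = (cmod (F x y))\<^sup>2"
  have q: "0 \<le> a - 2 * r * d + r\<^sup>2 * d * b" for r :: real
  proof -
    \<comment> \<open>The phase of \<open>cnj (F x y)\<close> makes the cross term real and
      negative, so a quadratic polynomial in the real parameter \<open>r\<close> remains.\<close>
    define t where "t = - complex_of_real r * cnj (F x y)"
    have "t * F x y = - complex_of_real (r * d)"
      unfolding t_def d_def of_real_mult complex_norm_square by simp
    moreover have "(cmod t)\<^sup>2 = r\<^sup>2 * d"
      by (simp add: t_def d_def norm_mult power_mult_distrib)
    ultimately show ?thesis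
      using F_expand[OF assms, of t] F_pos[of "x + sc t y"] assms
      by (simp add: S_add S_sc a_def b_def)
  qed
  have a0: "a \<ge> 0" and b0: "b \<ge> 0" and d0: "d \<ge> 0" using F_pos assms by (auto simp: a_def b_def d_def)
  have "d \<le> a * b"
  proof (cases "b = 0")
    case True
    have "d = 0"
    proof (rule ccontr)
      assume "d \<noteq> 0"
      \<comment> \<open>For a null vector \<open>y\<close> the polynomial is affine; this
        \<open>r\<close> gives it the value -1.\<close>
      then have "2 * ((a + 1) / (2 * d)) * d = a + 1" by (simp add: field_simps)
      then show False using q[of "(a + 1) / (2 * d)"] True by simp
    qed
    then show ?thesis using True by simp
  next
    case False
    then have "b > 0" using b0 by simp
    moreover have "0 \<le> a - d / b" using q[of "1 / b"] False by (simp add: power2_eq_square)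
    ultimately show ?thesis by (simp add: field_simps)
  qed
  then have "(cmod (F x y))\<^sup>2 \<le> (sn x * sn y)\<^sup>2"
    using assms by (simp add: power_mult_distrib sn_sq a_def b_def d_def)
  then show ?thesis
    by (rule power2_le_imp_le) (simp add: sn_nonneg assms)
qed

lemma sn_triangle:
  assumes "x \<in> S" "y \<in> S"
  shows "sn (x + y) \<le> sn x + sn y"
proof -
  have "(sn (x + y))\<^sup>2 = (sn x)\<^sup>2 + 2 * Re (F x y) + (sn y)\<^sup>2"
    using F_expand[OF assms, of 1] assms by (simp add: sn_sq S_add)
  also have "\<dots> \<le> (sn x + sn y)\<^sup>2"
    using Cauchy_Schwarz[OF assms] complex_Re_le_cmod[of "F x y"] by (simp add: power2_sum)
  finally show ?thesis
    by (rule power2_le_imp_le) (simp add: sn_nonneg assms)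
qed

lemma sn_scale: "x \<in> S \<Longrightarrow> sn (sc c x) = cmod c * sn x"
proof -
  assume x: "x \<in> S"
  have "F (sc c x) (sc c x) = (cnj c * c) * F x x"
    using x by (simp add: F_sc F_sc_left S_sc)
  then have "Re (F (sc c x) (sc c x)) = (cmod c)\<^sup>2 * Re (F x x)"
    using F_self[OF x]
    by (metis Re_complex_of_real complex_norm_square mult.commute of_real_mult)
  then show ?thesis by (simp add: sn_def real_sqrt_mult)
qed

lemma sn_minus_commute: "x \<in> S \<Longrightarrow> y \<in> S \<Longrightarrow> sn (x - y) = sn (y - x)"
  using sn_scale[of "x - y" "-1"] by (simp add: S_diff)

lemma sn_triangle_diff: "x \<in> S \<Longrightarrow> y \<in> S \<Longrightarrow> z \<in> S \<Longrightarrow> sn (x - z) \<le> sn (x - y) + sn (y - z)"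
  using sn_triangle[of "x - y" "y - z"] by (simp add: S_diff)

section \<open>Seminorm-Cauchy sequences and Riesz representation\<close>

definition scauchy :: "(nat \<Rightarrow> 'a) \<Rightarrow> bool" where
  "scauchy s \<longleftrightarrow> (\<forall>n. s n \<in> S) \<and> (\<forall>e>0. \<exists>N. \<forall>m\<ge>N. \<forall>n\<ge>N. sn (s m - s n) < e)"

lemma scauchy_bounded:
  assumes "scauchy s" obtains C where "C \<ge> 0" "\<And>n. sn (s n) \<le> C"
proof -
  have S: "\<And>n. s n \<in> S" using assms by (simp add: scauchy_def)
  obtain N where N: "\<And>m n. m \<ge> N \<Longrightarrow> n \<ge> N \<Longrightarrow> sn (s m - s n) < 1"
    using assms unfolding scauchy_def by (metis zero_less_one)
  define C where "C = sn (s N) + 1 + (\<Sum>n<N. sn (s n))"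
  have sp: "0 \<le> (\<Sum>n<N. sn (s n))" by (intro sum_nonneg) (simp add: S sn_nonneg)
  have "sn (s n) \<le> C" for n
  proof (cases "n < N")
    case True
    then have "sn (s n) \<le> (\<Sum>n<N. sn (s n))"
      by (intro member_le_sum) (auto simp: S sn_nonneg)
    then show ?thesis using sn_nonneg[OF S, of N] by (simp add: C_def)
  next
    case False
    then have "sn (s n - s N) < 1" using N by simp
    then show ?thesis using sn_triangle[of "s n - s N" "s N"] S sp by (simp add: C_def S_diff)
  qed
  moreover have "C \<ge> 0" using sp sn_nonneg[OF S, of N] by (simp add: C_def)
  ultimately show ?thesis using that by blast
qed

lemma scauchy_convergent_F:
  assumes s: "scauchy s" and A: "A \<in> S"
  shows "convergent (\<lambda>n. F (s n) A)"
proof (rule Cauchy_convergent, rule CauchyI)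
  fix e :: real assume e: "e > 0"
  have S: "\<And>n. s n \<in> S" using s by (simp add: scauchy_def)
  have p: "sn A + 1 > 0" using sn_nonneg[OF A] by simp
  obtain N where N: "\<And>m n. m \<ge> N \<Longrightarrow> n \<ge> N \<Longrightarrow> sn (s m - s n) < e / (sn A + 1)"
    using s e p unfolding scauchy_def by (metis divide_pos_pos)
  have "norm (F (s m) A - F (s n) A) < e" if "m \<ge> N" "n \<ge> N" for m n
  proof -
    have "norm (F (s m) A - F (s n) A) \<le> sn (s m - s n) * sn A"
      using Cauchy_Schwarz[of "s m - s n" A] S A by (simp add: F_diff_left S_diff)
    also have "\<dots> \<le> sn (s m - s n) * (sn A + 1)"
      using sn_nonneg[OF S_diff[OF S S]] by (intro mult_left_mono) auto
    also have "\<dots> < e" using N[OF that] p by (simp add: field_simps)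
    finally show ?thesis .
  qed
  then show "\<exists>N. \<forall>m\<ge>N. \<forall>n\<ge>N. norm (F (s m) A - F (s n) A) < e" by blast
qed

text \<open>Split the square of \<open>sn (u n)\<close> as
  \<open>F (u n) (u N) + F (u n) (u n - u N)\<close> with \<open>N\<close> frozen: the first term
  vanishes by weak convergence, the second is small because \<open>u\<close> is bounded and
  Cauchy.\<close>

lemma scauchy_weakly_null:
  assumes u: "scauchy u" and w: "\<And>A. A \<in> S \<Longrightarrow> (\<lambda>n. F (u n) A) \<longlonglongrightarrow> 0"
  shows "(\<lambda>n. sn (u n)) \<longlonglongrightarrow> 0"
proof -
  have S: "\<And>n. u n \<in> S" using u by (simp add: scauchy_def)
  obtain C where C: "C \<ge> 0" "\<And>n. sn (u n) \<le> C" using scauchy_bounded[OF u] by blast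
  have "(\<lambda>n. (sn (u n))\<^sup>2) \<longlonglongrightarrow> 0"
  proof (rule LIMSEQ_I)
    fix e :: real assume e: "e > 0"
    have p: "2 * (C + 1) > 0" using C by simp
    obtain N where N: "\<And>m n. m \<ge> N \<Longrightarrow> n \<ge> N \<Longrightarrow> sn (u m - u n) < e / (2 * (C + 1))"
      using u e p unfolding scauchy_def by (metis divide_pos_pos)
    obtain M where M: "\<And>n. n \<ge> M \<Longrightarrow> cmod (F (u n) (u N)) < e / 2"
      using LIMSEQ_D[OF w[OF S[of N]], of "e / 2"] e by auto
    have "norm ((sn (u n))\<^sup>2 - 0) < e" if n: "n \<ge> max M N" for n
    proof -
      have "(sn (u n))\<^sup>2 = Re (F (u n) (u N)) + Re (F (u n) (u n - u N))"
        using S by (simp add: sn_sq F_diff)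
      also have "\<dots> \<le> cmod (F (u n) (u N)) + cmod (F (u n) (u n - u N))"
        by (intro add_mono complex_Re_le_cmod)
      also have "cmod (F (u n) (u n - u N)) \<le> sn (u n) * sn (u n - u N)"
        by (intro Cauchy_Schwarz S_diff S)
      also have "sn (u n) * sn (u n - u N) \<le> (C + 1) * (e / (2 * (C + 1)))"
        using N[of n N] n C(2)[of n] C(1) sn_nonneg[OF S_diff[OF S S]]
        by (intro mult_mono) (auto intro: less_imp_le)
      also have "\<dots> = e / 2" using C(1) by (simp add: field_simps)
      finally show ?thesis using M[of n] n by simp
    qed
    then show "\<exists>no. \<forall>n\<ge>no. norm ((sn (u n))\<^sup>2 - 0) < e" by blast
  qed
  then have "(\<lambda>n. sqrt ((sn (u n))\<^sup>2)) \<longlonglongrightarrow> sqrt 0" by (rule tendsto_real_sqrt)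
  then show ?thesis using sn_nonneg[OF S] by simp
qed

text \<open>The representing sequence minimises \<open>\<parallel>u\<parallel>\<^sup>2 - 2 Re (q u)\<close>; the parallelogram law makes it Cauchy.\<close>

lemma Riesz_representation:
  assumes q_add: "\<And>x y. x \<in> S \<Longrightarrow> y \<in> S \<Longrightarrow> q (x + y) = q x + q y"
    and q_sc: "\<And>c x. x \<in> S \<Longrightarrow> q (sc c x) = c * q x"
    and q_bd: "\<And>x. x \<in> S \<Longrightarrow> cmod (q x) \<le> C * sn x"
  obtains s where "scauchy s" "\<And>A. A \<in> S \<Longrightarrow> (\<lambda>n. F (s n) A) \<longlonglongrightarrow> q A"
proof -
  define J where "J u = (sn u)\<^sup>2 - 2 * Re (q u)" for u
  have J_lb: "- C\<^sup>2 \<le> J u" if "u \<in> S" for u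
  proof -
    have "Re (q u) \<le> C * sn u" using q_bd[OF that] complex_Re_le_cmod order_trans by blast
    moreover have "0 \<le> (sn u - C)\<^sup>2" by simp
    ultimately show ?thesis by (simp add: J_def power2_diff mult.commute)
  qed
  define I where "I = Inf (J ` S)"
  have bdd: "bdd_below (J ` S)" using J_lb by (intro bdd_belowI[of _ "- C\<^sup>2"]) auto
  have I_le: "I \<le> J u" if "u \<in> S" for u
    unfolding I_def using that bdd by (intro cInf_lower) auto
  have ne: "J ` S \<noteq> {}" using S_zero by auto
  have "\<exists>u. u \<in> S \<and> J u < I + 1 / real (Suc n)" for n
    using cInf_lessD[OF ne, of "I + 1 / real (Suc n)"] unfolding I_def by auto
  then obtain s where s: "\<And>n. s n \<in> S" and Js: "\<And>n. J (s n) < I + 1 / real (Suc n)"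
    by metis
  have par: "(sn (u - v))\<^sup>2 \<le> 2 * (J u - I) + 2 * (J v - I)" if uv: "u \<in> S" "v \<in> S" for u v
  proof -
    \<comment> \<open>The midpoint of \<open>u\<close> and \<open>v\<close> competes for the
      infimum, which turns the parallelogram law into a bound on \<open>u - v\<close>.\<close>
    have w: "sc (1/2) (u + v) \<in> S" using uv by (intro S_sc S_add)
    have e1: "(sn (u - v))\<^sup>2 = (sn u)\<^sup>2 - 2 * Re (F u v) + (sn v)\<^sup>2"
      using F_expand[OF uv, of "-1"] uv by (simp add: sn_sq S_diff)
    have e2: "(sn (u + v))\<^sup>2 = (sn u)\<^sup>2 + 2 * Re (F u v) + (sn v)\<^sup>2"
      using F_expand[OF uv, of 1] uv by (simp add: sn_sq S_add)
    have e3: "(sn (sc (1/2) (u + v)))\<^sup>2 = (sn (u + v))\<^sup>2 / 4"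
      by (simp only: sn_scale[OF S_add[OF uv]]) (simp add: power_mult_distrib power_divide norm_divide)
    have "q (sc (1/2) (u + v)) = (q u + q v) / 2"
      using q_sc[of "u + v" "1/2"] q_add uv by (simp add: S_add)
    then have e4: "Re (q (sc (1/2) (u + v))) = (Re (q u) + Re (q v)) / 2"
      by (metis Re_divide_numeral plus_complex.simps(1))
    have "(sn (u - v))\<^sup>2 = 2 * J u + 2 * J v - 4 * J (sc (1/2) (u + v))"
      unfolding J_def e1 e3 e2 e4 by (simp add: field_simps)
    then show ?thesis using I_le[OF w] by simp
  qed
  have "scauchy s"
    unfolding scauchy_def
  proof (intro conjI allI impI s)
    fix e :: real assume e: "e > 0"
    obtain N :: nat where N: "N > 0" "1 / real N < e\<^sup>2 / 4"
      using e by (metis ex_inverse_of_nat_less inverse_eq_divide zero_less_divide_iff zero_less_power zero_less_numeral)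
    have small: "J (s n) - I < e\<^sup>2 / 4" if "n \<ge> N" for n
    proof -
      have "1 / real (Suc n) \<le> 1 / real N" using that N by (intro divide_left_mono) auto
      then show ?thesis using Js[of n] N by simp
    qed
    have "sn (s m - s n) < e" if "m \<ge> N" "n \<ge> N" for m n
    proof -
      have "(sn (s m - s n))\<^sup>2 < e\<^sup>2"
        using par[OF s s, of m n] small[OF that(1)] small[OF that(2)] by simp
      then show ?thesis using e power_less_imp_less_base[of _ 2 e] by simp
    qed
    then show "\<exists>N. \<forall>m\<ge>N. \<forall>n\<ge>N. sn (s m - s n) < e" by blast
  qed
  moreover have "(\<lambda>n. F (s n) A) \<longlonglongrightarrow> q A" if A: "A \<in> S" for A
  proof -
    define M where "M = Re (F A A)"
    have M: "M \<ge> 0" using F_pos[OF A] by (simp add: M_def)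
    have key: "(cmod (F (s n) A - q A))\<^sup>2 \<le> (M + 1) * (1 / real (Suc n))" for n
    proof -
      \<comment> \<open>First variation at the almost-minimiser \<open>s n\<close> in the direction
        of \<open>A\<close>. The step \<open>1 / (M + 1)\<close> is near the optimal one and stays
        meaningful when \<open>A\<close> is a null vector.\<close>
      define d r t where "d = F (s n) A - q A" and "r = 1 / (M + 1)"
        and "t = - complex_of_real r * cnj d"
      have "J (s n + sc t A) = J (s n) + 2 * Re (t * d) + (cmod t)\<^sup>2 * M"
        using F_expand[OF s A, of n t] s[of n] A
        by (simp add: J_def sn_sq S_add S_sc q_add q_sc d_def M_def algebra_simps)
      moreover have "t * d = - complex_of_real (r * (cmod d)\<^sup>2)"
        unfolding t_def of_real_mult complex_norm_square by simp
      moreover have "(cmod t)\<^sup>2 = r\<^sup>2 * (cmod d)\<^sup>2"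
        by (simp add: t_def norm_mult power_mult_distrib)
      ultimately have "0 \<le> 1 / real (Suc n) - 2 * (r * (cmod d)\<^sup>2) + r\<^sup>2 * (cmod d)\<^sup>2 * M"
        using I_le[of "s n + sc t A"] Js[of n] s A by (simp add: S_add S_sc)
      moreover have "r\<^sup>2 * (cmod d)\<^sup>2 * M \<le> r * (cmod d)\<^sup>2"
      proof -
        have "r * M \<le> 1" "r \<ge> 0" using M by (auto simp: r_def field_simps)
        then have "(r * M) * (r * (cmod d)\<^sup>2) \<le> 1 * (r * (cmod d)\<^sup>2)" by (intro mult_right_mono) auto
        then show ?thesis by (simp add: power2_eq_square algebra_simps)
      qed
      ultimately have "r * (cmod d)\<^sup>2 \<le> 1 / real (Suc n)" by simp
      then show ?thesis using M by (simp add: r_def d_def field_simps)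
    qed
    have "(\<lambda>n. (M + 1) * (1 / real (Suc n))) \<longlonglongrightarrow> 0"
      using tendsto_mult_right_zero[OF LIMSEQ_inverse_real_of_nat] by (simp add: inverse_eq_divide)
    then have "(\<lambda>n. (cmod (F (s n) A - q A))\<^sup>2) \<longlonglongrightarrow> 0"
      by (rule real_tendsto_sandwich[OF _ _ tendsto_const, rotated 2])
        (use key in auto)
    then have "(\<lambda>n. sqrt ((cmod (F (s n) A - q A))\<^sup>2)) \<longlonglongrightarrow> sqrt 0" by (rule tendsto_real_sqrt)
    then have "(\<lambda>n. cmod (F (s n) A - q A)) \<longlonglongrightarrow> 0" by simp
    then show ?thesis using LIM_zero_cancel tendsto_norm_zero_iff by blast
  qed
  ultimately show ?thesis using that by blast
qed

end

section \<open>Finite-dimensional subspaces and automorphisms of C*-algebras\<close>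

text \<open>A constant factor is washed out by repeated squaring: if x > y > 0, the powers of x / y
  exceed every \<open>C\<close>.\<close>

lemma le_of_power_two_bound:
  fixes x y C :: real
  assumes y: "0 \<le> y" and b: "\<And>n. x ^ 2 ^ n \<le> C * y ^ 2 ^ n"
  shows "x \<le> y"
proof (rule ccontr)
  assume "\<not> x \<le> y"
  then have xy: "y < x" by simp
  show False
  proof (cases "y = 0")
    case True
    then show ?thesis using b[of 0] xy by simp
  next
    case False
    then have y: "y > 0" using y by simp
    then have r: "1 < x / y" using xy by simp
    then obtain n where n: "C < (x / y) ^ n" using real_arch_pow by blast
    also have "\<dots> \<le> (x / y) ^ 2 ^ n"
      using r by (intro power_increasing) (auto intro: less_imp_le[OF less_exp])
    also have "\<dots> \<le> C" using b[of n] y by (simp add: power_divide field_simps)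
    finally show False by simp
  qed
qed

locale cstar =
  fixes sc :: "complex \<Rightarrow> 'a::{real_normed_algebra_1,banach} \<Rightarrow> 'a" and st :: "'a \<Rightarrow> 'a"
  assumes cstar_algebra: "cstar_algebra sc st"
begin

sublocale vector_space sc
  using cstar_algebra by (simp add: cstar_algebra_def)

lemma norm_sc: "norm (sc c A) = cmod c * norm A"
  and st_st: "st (st A) = A"
  and st_add: "st (A + B) = st A + st B"
  and st_sc: "st (sc c A) = sc (cnj c) (st A)"
  and st_mult: "st (A * B) = st B * st A"
  and norm_st_mult_self: "norm (st A * A) = (norm A)\<^sup>2"
  using cstar_algebra unfolding cstar_algebra_def by simp_all

lemma sc_mult_left: "sc c A * B = sc c (A * B)" and sc_mult_right: "A * sc c B = sc c (A * B)"
proof -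
  have "\<forall>c A B. sc c (A * B) = sc c A * B \<and> sc c (A * B) = A * sc c B"
    using cstar_algebra unfolding cstar_algebra_def by blast
  then have h: "sc c (A * B) = sc c A * B" "sc c (A * B) = A * sc c B" by blast+
  show "sc c A * B = sc c (A * B)" "A * sc c B = sc c (A * B)"
    by (rule h(1)[symmetric], rule h(2)[symmetric])
qed

lemma st_zero: "st 0 = 0"
  using st_add[of 0 0] by simp

lemma st_one: "st 1 = 1"
  using st_mult[of 1 "st 1"] by (simp add: st_st)

lemma st_diff: "st (A - B) = st A - st B"
  using st_add[of "A - B" B] by (simp add: algebra_simps)

lemma st_sum: "st (sum f X) = (\<Sum>x\<in>X. st (f x))"
  by (induction X rule: infinite_finite_induct) (auto simp: st_zero st_add)

lemma norm_le_norm_st: "norm A \<le> norm (st A)"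
proof (cases "A = 0")
  case False
  have "norm A * norm A \<le> norm (st A) * norm A"
    using norm_st_mult_self[of A] norm_mult_ineq[of "st A" A] by (simp add: power2_eq_square)
  then show ?thesis using False by simp
qed simp

lemma norm_st: "norm (st A) = norm A"
  using norm_le_norm_st[of A] norm_le_norm_st[of "st A"] by (simp add: st_st)

text \<open>A point outside a closed subspace has positive distance \<open>d\<close> from it, and
  dividing \<open>x\<close> by \<open>k\<close> compares \<open>x\<close> with that distance. The
  coordinate along \<open>b\<close> is thus bounded, which drives both inductions on dimension
  below.\<close>

lemma span_insert_coeff_bound:
  assumes "closed (span B)" "b \<notin> span B"
  obtains d where "d > 0" "\<And>x k. x - sc k b \<in> span B \<Longrightarrow> cmod k * d \<le> norm x"
proof -
  obtain d where d: "d > 0" "\<And>y. y \<in> span B \<Longrightarrow> d \<le> dist b y"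
  proof -
    obtain d where "d > 0" "ball b d \<subseteq> - span B"
      using assms open_contains_ball[of "- span B"] by auto
    then show ?thesis using that by (force simp: subset_iff not_less)
  qed
  have "cmod k * d \<le> norm x" if x: "x - sc k b \<in> span B" for x k
  proof (cases "k = 0")
    case False
    have "sc (- (1 / k)) (x - sc k b) \<in> span B" using x by (rule span_scale)
    also have "sc (- (1 / k)) (x - sc k b) = b - sc (1 / k) x"
      using False by (simp add: scale_right_diff_distrib)
    finally have "d \<le> dist b (b - sc (1 / k) x)" by (rule d(2))
    also have "\<dots> = norm x / cmod k" by (simp add: dist_norm norm_sc norm_divide)
    finally show ?thesis using False by (simp add: field_simps)
  qed simp
  then show ?thesis using that d(1) by blast
qed

text \<open>Along a convergent sequence the coordinates at the new vector are Cauchy; subtracting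
  their contribution leaves a convergent sequence in the smaller closed span.\<close>

lemma closed_span_finite: "finite B \<Longrightarrow> closed (span B)"
proof (induction B rule: finite_induct)
  case (insert b B)
  show ?case
  proof (cases "b \<in> span B")
    case True
    then show ?thesis using insert.IH by (simp add: span_redundant)
  next
    case False
    obtain d where d: "d > 0" "\<And>x k. x - sc k b \<in> span B \<Longrightarrow> cmod k * d \<le> norm x"
      using span_insert_coeff_bound[OF insert.IH False] by blast
    show ?thesis
      unfolding closed_sequential_limits
    proof (intro allI impI)
      fix x l assume x: "(\<forall>n. x n \<in> span (insert b B)) \<and> x \<longlonglongrightarrow> l"
      then have "\<forall>n. \<exists>k. x n - sc k b \<in> span B" by (simp add: span_insert)
      then obtain k where k: "\<And>n. x n - sc (k n) b \<in> span B" by metis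
      have "Cauchy k"
      proof (rule CauchyI)
        fix e :: real assume e: "e > 0"
        have "Cauchy x" using x LIMSEQ_imp_Cauchy by blast
        then obtain N where N: "\<And>m n. m \<ge> N \<Longrightarrow> n \<ge> N \<Longrightarrow> norm (x m - x n) < e * d"
          using CauchyD[of x "e * d"] e d(1) by auto
        have "norm (k m - k n) < e" if "m \<ge> N" "n \<ge> N" for m n
        proof -
          have swap: "(u - v) - (w - z) = (u - w) - (v - z)" for u v w z :: 'a
            by (simp add: algebra_simps)
          have "(x m - x n) - sc (k m - k n) b \<in> span B"
            using span_diff[OF k[of m] k[of n]] by (simp add: scale_left_diff_distrib swap[of "x m" "x n"])
          then have "cmod (k m - k n) * d \<le> norm (x m - x n)" by (rule d(2))
          also have "\<dots> < e * d" by (rule N[OF that])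
          finally show ?thesis using d(1) by simp
        qed
        then show "\<exists>M. \<forall>m\<ge>M. \<forall>n\<ge>M. norm (k m - k n) < e" by blast
      qed
      then obtain c where c: "k \<longlonglongrightarrow> c" using Cauchy_convergent convergent_def by blast
      have "(\<lambda>n. sc (k n) b) \<longlonglongrightarrow> sc c b"
      proof (rule LIM_zero_cancel, rule Lim_null_comparison)
        show "\<forall>\<^sub>F n in sequentially. norm (sc (k n) b - sc c b) \<le> cmod (k n - c) * norm b"
          by (simp only: norm_sc order_refl eventually_True scale_left_diff_distrib[symmetric])
        show "(\<lambda>n. cmod (k n - c) * norm b) \<longlonglongrightarrow> 0"
          using c by (intro tendsto_mult_left_zero) (simp add: LIM_zero tendsto_norm_zero)
      qed
      then have "(\<lambda>n. x n - sc (k n) b) \<longlonglongrightarrow> l - sc c b" using x by (intro tendsto_diff) auto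
      then have "l - sc c b \<in> span B"
        by (rule closed_sequentially[OF insert.IH, rotated]) (rule k)
      then show "l \<in> span (insert b B)" by (auto simp: span_insert)
    qed
  qed
qed simp

lemma linear_bounded_on_span:
  assumes B: "finite B"
    and add: "\<And>x y. \<phi> (x + y) = \<phi> x + \<phi> y" and sc: "\<And>c x. \<phi> (sc c x) = sc c (\<phi> x)"
  shows "\<exists>C. \<forall>x\<in>span B. norm (\<phi> x :: 'a) \<le> C * norm x"
  using B
proof (induction B rule: finite_induct)
  case empty
  have "\<phi> 0 = 0" using add[of 0 0] by simp
  then show ?case by simp
next
  case (insert b B)
  then obtain C where C: "\<And>x. x \<in> span B \<Longrightarrow> norm (\<phi> x) \<le> C * norm x" by blast
  have C': "norm (\<phi> x) \<le> \<bar>C\<bar> * norm x" if "x \<in> span B" for x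
    by (rule order_trans[OF C[OF that]]) (intro mult_right_mono, auto)
  show ?case
  proof (cases "b \<in> span B")
    case True
    then show ?thesis using C by (auto simp: span_redundant)
  next
    case False
    obtain d where d: "d > 0" "\<And>x k. x - sc k b \<in> span B \<Longrightarrow> cmod k * d \<le> norm x"
      using span_insert_coeff_bound[OF closed_span_finite[OF insert.hyps(1)] False] by blast
    have "norm (\<phi> x) \<le> (\<bar>C\<bar> * (1 + norm b / d) + norm (\<phi> b) / d) * norm x"
      if x: "x \<in> span (insert b B)" for x
    proof -
      obtain k where k: "x - sc k b \<in> span B" using x unfolding span_insert by blast
      have kd: "cmod k \<le> norm x / d" using d(2)[OF k] d(1) by (simp add: field_simps)
      have "norm (x - sc k b) \<le> norm x + cmod k * norm b"
        using norm_triangle_ineq4[of x "sc k b"] by (simp add: norm_sc)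
      also have "\<dots> \<le> norm x + norm x / d * norm b"
        by (intro add_left_mono mult_right_mono kd) auto
      finally have 1: "norm (\<phi> (x - sc k b)) \<le> \<bar>C\<bar> * (norm x + norm x / d * norm b)"
        by (intro order_trans[OF C'[OF k]] mult_left_mono) auto
      have 2: "norm (\<phi> (sc k b)) \<le> norm x / d * norm (\<phi> b)"
        by (simp only: sc norm_sc) (intro mult_right_mono kd norm_ge_zero)
      have "\<phi> x = \<phi> (x - sc k b) + \<phi> (sc k b)" using add[of "x - sc k b" "sc k b"] by simp
      then have "norm (\<phi> x) \<le> norm (\<phi> (x - sc k b)) + norm (\<phi> (sc k b))"
        by (simp add: norm_triangle_ineq)
      also have "\<dots> \<le> \<bar>C\<bar> * (norm x + norm x / d * norm b) + norm x / d * norm (\<phi> b)"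
        using 1 2 by simp
      also have "\<dots> = (\<bar>C\<bar> * (1 + norm b / d) + norm (\<phi> b) / d) * norm x"
        by (simp add: distrib_left distrib_right mult.commute mult.left_commute)
      finally show ?thesis .
    qed
    then show ?thesis by blast
  qed
qed

text \<open>For self-adjoint elements the C*-identity squares the norm exactly at each doubling of
  the exponent. Being an equality, it applies to \<open>h\<close> and to its image under an
  automorphism alike.\<close>

lemma norm_self_adjoint_power:
  assumes "st h = h" shows "norm (h ^ 2 ^ n) = norm h ^ 2 ^ n"
proof (induction n)
  case (Suc n)
  have st_pow: "st (h ^ k) = h ^ k" for k
    by (induction k) (auto simp: st_one st_mult assms power_commutes)
  have "h ^ 2 ^ Suc n = st (h ^ 2 ^ n) * h ^ 2 ^ n"
    by (simp add: st_pow mult_2 power_add)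
  then have "norm (h ^ 2 ^ Suc n) = (norm (h ^ 2 ^ n))\<^sup>2" by (metis norm_st_mult_self)
  also have "\<dots> = norm h ^ 2 ^ Suc n" by (simp add: Suc power2_eq_square mult_2 power_add)
  finally show ?case .
qed simp

text \<open>On a finite-dimensional subalgebra the spectral theory behind the contractivity of
  *-homomorphisms is replaced by comparing \<open>\<parallel>\<phi>(h\<^sup>N)\<parallel> \<le> C \<parallel>h\<^sup>N\<parallel>\<close> for \<open>N = 2\<^sup>n\<close>
  and \<open>h = a\<^sup>* a\<close>.\<close>

lemma star_automorphism_contractive:
  assumes \<phi>: "star_automorphism sc st \<phi>" and B: "finite B" "a \<in> span B"
    and one: "1 \<in> span B"
    and mult: "\<And>x y. x \<in> span B \<Longrightarrow> y \<in> span B \<Longrightarrow> x * y \<in> span B"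
    and star: "\<And>x. x \<in> span B \<Longrightarrow> st x \<in> span B"
  shows "norm (\<phi> a) \<le> norm a"
proof -
  have \<phi>_add: "\<And>x y. \<phi> (x + y) = \<phi> x + \<phi> y" and \<phi>_sc: "\<And>c x. \<phi> (sc c x) = sc c (\<phi> x)"
    and \<phi>_mult: "\<And>x y. \<phi> (x * y) = \<phi> x * \<phi> y" and \<phi>_one: "\<phi> 1 = 1"
    and \<phi>_st: "\<And>x. \<phi> (st x) = st (\<phi> x)"
    using \<phi> by (auto simp: star_automorphism_def)
  obtain C where C: "\<And>x. x \<in> span B \<Longrightarrow> norm (\<phi> x) \<le> C * norm x"
    using linear_bounded_on_span[OF B(1) \<phi>_add \<phi>_sc] by blast
  define h where "h = st a * a"
  have h: "st h = h" "st (\<phi> h) = \<phi> h"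
    by (auto simp: h_def st_mult st_st \<phi>_mult \<phi>_st)
  have hB: "h ^ k \<in> span B" for k
    by (induction k) (auto simp: one mult h_def star B)
  have \<phi>_pow: "\<phi> (h ^ k) = \<phi> h ^ k" for k
    by (induction k) (auto simp: \<phi>_one \<phi>_mult)
  have "norm (\<phi> h) ^ 2 ^ n \<le> C * norm h ^ 2 ^ n" for n
    using C[OF hB, of "2 ^ n"] by (simp add: \<phi>_pow norm_self_adjoint_power h)
  then have "norm (\<phi> h) \<le> norm h" by (rule le_of_power_two_bound[rotated]) simp
  then have "(norm (\<phi> a))\<^sup>2 \<le> (norm a)\<^sup>2"
    by (simp add: h_def \<phi>_mult \<phi>_st norm_st_mult_self)
  then show ?thesis by (rule power2_le_imp_le) simp
qed

end

section \<open>Cubes and summable weights on the lattice\<close>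

lemma ldist_translate: "ldist (x + z) (y + z) = ldist x y"
  by (simp add: ldist_def)

lemma ldist_nonneg: "0 \<le> ldist x y"
  by (simp add: ldist_def sum_nonneg)

lemma ldist_triangle: "ldist x z \<le> ldist x y + ldist y z"
  unfolding ldist_def sum.distrib[symmetric] by (intro sum_mono) simp

lemma ldist_commute: "ldist x y = ldist y x"
  by (simp add: ldist_def abs_minus_commute)

lemma abs_nth_le_ldist: "\<bar>x $ i\<bar> \<le> ldist x 0"
  unfolding ldist_def using member_le_sum[of i UNIV "\<lambda>i. \<bar>x $ i - 0 $ i\<bar>"] by simp

text \<open>Balls of the maximum norm: as products of intervals they have an explicit cardinality,
  and product weights sum over them coordinate by coordinate.\<close>

definition cube :: "nat \<Rightarrow> (int ^ 'd) set" where
  "cube m = {x. \<forall>i. \<bar>x $ i\<bar> \<le> int m}"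

lemma cube_eq_image: "cube m = vec_lambda ` (\<Pi>\<^sub>E i\<in>UNIV. {- int m..int m})"
proof (intro set_eqI iffI)
  fix x :: "int ^ 'd" assume "x \<in> cube m"
  then have "vec_nth x \<in> (\<Pi>\<^sub>E i\<in>UNIV. {- int m..int m})"
    by (auto simp: cube_def PiE_def abs_le_iff minus_le_iff)
  then show "x \<in> vec_lambda ` (\<Pi>\<^sub>E i\<in>UNIV. {- int m..int m})"
    by (metis (no_types, lifting) image_eqI vec_nth_inverse)
qed (auto simp: cube_def PiE_def Pi_def abs_le_iff minus_le_iff)

lemma inj_vec_lambda: "inj_on vec_lambda A"
  by (metis inj_onI UNIV_I vec_lambda_inverse)

lemma finite_cube: "finite (cube m)"
  unfolding cube_eq_image by (intro finite_imageI finite_PiE) auto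

lemma card_cube: "card (cube m :: (int ^ 'd) set) = (2 * m + 1) ^ CARD('d)"
  unfolding cube_eq_image
  by (subst card_image[OF inj_vec_lambda]) (simp add: card_PiE nat_add_distrib nat_mult_distrib)

lemma cube_mono: "m \<le> n \<Longrightarrow> cube m \<subseteq> cube n"
  by (auto simp: cube_def intro: order_trans)

lemma card_cube_pos: "card (cube m :: (int ^ 'd) set) > 0"
  by (simp add: card_cube)

lemma lball_subset_cube: "r \<le> real m \<Longrightarrow> lball r \<subseteq> cube m"
proof
  fix x :: "int ^ 'd" assume r: "r \<le> real m" and x: "x \<in> lball r"
  have "\<bar>x $ i\<bar> \<le> int m" for i
    using abs_nth_le_ldist[of x i] x r by (simp add: lball_def)
  then show "x \<in> cube m" by (simp add: cube_def)
qed

lemma ldist_cube_le: "x \<in> cube m \<Longrightarrow> ldist (x :: int ^ 'd) 0 \<le> int (CARD('d) * m)"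
  unfolding ldist_def
  using sum_bounded_above[of UNIV "\<lambda>i. \<bar>x $ i - 0 $ i\<bar>" "int m"] by (simp add: cube_def)

lemma cube_subset_lball: "real (CARD('d) * m) \<le> r \<Longrightarrow> cube m \<subseteq> (lball r :: (int ^ 'd) set)"
proof
  fix x :: "int ^ 'd" assume r: "real (CARD('d) * m) \<le> r" and "x \<in> cube m"
  then have "real_of_int (ldist x 0) \<le> real_of_int (int (CARD('d) * m))"
    using ldist_cube_le of_int_le_iff by blast
  also have "\<dots> \<le> r" using r by simp
  finally show "x \<in> lball r" by (simp add: lball_def)
qed

lemma finite_lball: "finite (lball r)"
proof -
  obtain m :: nat where "r \<le> real m" using real_arch_simple by blast
  then show ?thesis using finite_subset[OF lball_subset_cube finite_cube] by blast
qed

lemma lball_mono: "r \<le> s \<Longrightarrow> lball r \<subseteq> lball s"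
  by (auto simp: lball_def)

lemma finite_subset_lball: "finite F \<Longrightarrow> \<exists>m. F \<subseteq> lball (real m)"
proof (induction F rule: finite_induct)
  case (insert x F)
  then obtain m where m: "F \<subseteq> lball (real m)" by blast
  define k where "k = max m (nat (ldist x 0))"
  have "x \<in> lball (real k)" by (auto simp: lball_def k_def)
  moreover have "lball (real m) \<subseteq> (lball (real k) :: (int ^ 'b) set)"
    by (intro lball_mono) (simp add: k_def)
  ultimately show ?case using m by blast
qed simp

lemma finite_subset_cube: "finite F \<Longrightarrow> \<exists>m. F \<subseteq> cube m"
  using finite_subset_lball lball_subset_cube by (meson order_refl subset_trans)

text \<open>Nested and exhausting, cubes allow unconditional sums over the lattice to be evaluated
  as limits along them.\<close>

lemma filterlim_cube: "filterlim cube (finite_subsets_at_top UNIV) sequentially"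
  unfolding filterlim_finite_subsets_at_top eventually_sequentially
  using finite_subset_cube cube_mono finite_cube by (metis subset_UNIV subset_trans)

text \<open>Each factor is at least (1 + |z|) to the power -q with |z| the l1 norm, so the product
  dominates the power -Dq of 1 + |z|, yet it is summable as soon as q > 1.\<close>

definition wt :: "real \<Rightarrow> int ^ 'd \<Rightarrow> real" where
  "wt q z = (\<Prod>i\<in>UNIV. (1 + real_of_int \<bar>z $ i\<bar>) powr (- q))"

lemma wt_nonneg: "0 \<le> wt q z"
  by (simp add: wt_def prod_nonneg)

lemma sum_wt_cube:
  "sum (wt q :: int ^ 'd \<Rightarrow> real) (cube m)
     = (\<Sum>j\<in>{- int m..int m}. (1 + real_of_int \<bar>j\<bar>) powr (- q)) ^ CARD('d)"
proof -
  have "sum (wt q :: int ^ 'd \<Rightarrow> real) (cube m)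
      = (\<Sum>g\<in>(\<Pi>\<^sub>E i\<in>(UNIV::'d set). {- int m..int m}). \<Prod>i\<in>UNIV. (1 + real_of_int \<bar>g i\<bar>) powr (- q))"
    unfolding cube_eq_image by (subst sum.reindex[OF inj_vec_lambda]) (simp add: wt_def o_def)
  also have "\<dots> = (\<Prod>i\<in>(UNIV::'d set). \<Sum>j\<in>{- int m..int m}. (1 + real_of_int \<bar>j\<bar>) powr (- q))"
    by (rule prod_sum_PiE[symmetric]) auto
  finally show ?thesis by simp
qed

lemma wt_summable:
  assumes "q > 1" shows "(wt q :: int ^ 'd \<Rightarrow> real) summable_on UNIV"
proof (rule nonneg_bdd_above_summable_on)
  let ?h = "\<lambda>n. (1 + real n) powr (- q)"
  have "summable (\<lambda>n. real (Suc n) powr (- q))"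
    using assms summable_real_powr_iff[of "- q"] by (subst summable_Suc_iff) simp
  then have sh: "summable ?h" by (simp add: add.commute)
  \<comment> \<open>The factor 2 covers both half-lines and counts the site 0 twice, which an upper
    bound permits.\<close>
  define T where "T = 2 * suminf ?h"
  have one_dim: "(\<Sum>j\<in>{- int m..int m}. (1 + real_of_int \<bar>j\<bar>) powr (- q)) \<le> T" for m
  proof -
    let ?g = "\<lambda>j::int. (1 + real_of_int \<bar>j\<bar>) powr (- q)"
    have "{- int m..int m} = int ` {..m} \<union> (\<lambda>n. - int n) ` {..m}"
    proof (intro set_eqI iffI)
      fix j assume "j \<in> {- int m..int m}"
      then show "j \<in> int ` {..m} \<union> (\<lambda>n. - int n) ` {..m}"
        by (cases "j \<ge> 0") (auto intro!: image_eqI[of _ _ "nat \<bar>j\<bar>"])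
    qed auto
    then have "sum ?g {- int m..int m} \<le> sum ?g (int ` {..m}) + sum ?g ((\<lambda>n. - int n) ` {..m})"
      using sum.union_inter[of "int ` {..m}" "(\<lambda>n. - int n) ` {..m}" ?g]
      by (smt (verit) finite_atMost finite_imageI powr_ge_zero sum_nonneg)
    also have "\<dots> = 2 * (\<Sum>n\<le>m. ?h n)"
      by (subst (1 2) sum.reindex) (auto simp: inj_on_def)
    also have "\<dots> \<le> T" unfolding T_def
      by (intro mult_left_mono sum_le_suminf sh) auto
    finally show ?thesis .
  qed
  show "bdd_above (sum (wt q) ` {F. F \<subseteq> (UNIV :: (int ^ 'd) set) \<and> finite F})"
  proof (rule bdd_aboveI2)
    fix F :: "(int ^ 'd) set" assume "F \<in> {F. F \<subseteq> UNIV \<and> finite F}"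
    then obtain m where F: "F \<subseteq> cube m" using finite_subset_cube by blast
    have "sum (wt q) F \<le> sum (wt q :: int ^ 'd \<Rightarrow> real) (cube m)"
      by (rule sum_mono2[OF finite_cube F]) (rule wt_nonneg)
    also have "\<dots> \<le> T ^ CARD('d)"
      unfolding sum_wt_cube by (intro power_mono one_dim sum_nonneg) auto
    finally show "sum (wt q) F \<le> T ^ CARD('d)" .
  qed
qed (rule wt_nonneg)

text \<open>The dimension enters only through the type of the lattice, hence the
  \<open>itself\<close> argument.\<close>

definition wt_tail :: "'d::finite itself \<Rightarrow> real \<Rightarrow> nat \<Rightarrow> real" where
  "wt_tail _ q r = infsum (wt q :: int ^ 'd \<Rightarrow> real) (- cube r)"

lemma wt_summable_on: "q > 1 \<Longrightarrow> wt q summable_on A"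
  using wt_summable summable_on_subset_banach by blast

lemma infsum_compl:
  fixes c :: "'b \<Rightarrow> 'c::banach"
  assumes "c summable_on UNIV" "finite Z"
  shows "infsum c (- Z) = infsum c UNIV - sum c Z"
proof -
  have "infsum c (Z \<union> - Z) = infsum c Z + infsum c (- Z)"
    using assms summable_on_subset_banach[OF assms(1)] by (intro infsum_Un_disjoint) auto
  then show ?thesis using assms by (simp add: Compl_partition)
qed

lemma wt_tail_tendsto:
  assumes "q > 1" shows "wt_tail TYPE('d::finite) q \<longlonglongrightarrow> 0"
proof -
  let ?w = "wt q :: int ^ 'd \<Rightarrow> real"
  have "(sum ?w \<longlongrightarrow> infsum ?w UNIV) (finite_subsets_at_top UNIV)"
    using has_sum_infsum[OF wt_summable[OF assms]] by (simp add: has_sum_def)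
  from filterlim_compose[OF this filterlim_cube]
  have "(\<lambda>r. infsum ?w UNIV - sum ?w (cube r)) \<longlonglongrightarrow> infsum ?w UNIV - infsum ?w UNIV"
    by (intro tendsto_diff tendsto_const)
  then show ?thesis
    by (simp add: wt_tail_def[abs_def] infsum_compl[OF wt_summable[OF assms] finite_cube])
qed

lemma wt_dominated_summable:
  fixes c :: "int ^ 'd \<Rightarrow> complex"
  assumes q: "q > 1" and c: "\<And>z. cmod (c z) \<le> K * wt q z"
  shows "(\<lambda>z. norm (c z)) summable_on A"
proof (rule Infinite_Sum.abs_summable_on_comparison_test)
  show "(\<lambda>z. norm (K * wt q z)) summable_on A"
    using summable_on_cmult_right[OF wt_summable_on[OF q], of "\<bar>K\<bar>" A]
    by (simp add: abs_mult wt_nonneg)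
  show "cmod (c z) \<le> norm (K * wt q z)" for z
    using c[of z] by (simp add: order_trans[OF _ abs_ge_self])
qed

lemma wt_dominated_remainder:
  fixes c :: "int ^ 'd \<Rightarrow> complex"
  assumes q: "q > 1" and c: "\<And>z. cmod (c z) \<le> K * wt q z" and Z: "finite Z"
  shows "cmod (sum c Z - infsum c UNIV) \<le> K * infsum (wt q) (- Z)"
proof -
  have "cmod (sum c Z - infsum c UNIV) = cmod (infsum c (- Z))"
    using infsum_compl[OF abs_summable_summable[OF wt_dominated_summable[OF q c]] Z]
    by (simp add: norm_minus_commute)
  also have "\<dots> \<le> infsum (\<lambda>z. cmod (c z)) (- Z)"
    by (rule norm_infsum_bound[OF wt_dominated_summable[OF q c]])
  also have "\<dots> \<le> infsum (\<lambda>z. K * wt q z) (- Z)"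
    by (intro infsum_mono wt_dominated_summable[OF q c] c summable_on_cmult_right wt_summable_on q)
  also have "\<dots> = K * infsum (wt q) (- Z)" by (rule infsum_cmult_right')
  finally show ?thesis .
qed

lemma wt_dominated_const_nonneg:
  fixes c :: "int ^ 'd \<Rightarrow> complex"
  assumes c: "\<And>z. cmod (c z) \<le> K * wt q z" shows "0 \<le> K"
proof -
  have "wt q (0 :: int ^ 'd) = 1" by (simp add: wt_def)
  then show ?thesis using c[of 0] by (metis mult.right_neutral norm_ge_zero order_trans)
qed

lemma infsum_wt_compl_le_tail:
  assumes "q > 1" "cube r \<subseteq> (Z :: (int ^ 'd) set)"
  shows "infsum (wt q) (- Z) \<le> wt_tail TYPE('d) q r"
  unfolding wt_tail_def
  by (intro infsum_mono2 wt_summable_on assms) (use assms in \<open>auto simp: wt_nonneg\<close>)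

lemma sum_shifted_cube:
  fixes c :: "int ^ 'd \<Rightarrow> 'b::comm_monoid_add"
  shows "(\<Sum>x\<in>cube m. c (x - y)) = sum c ((\<lambda>x. x - y) ` cube m)"
  by (subst sum.reindex) (auto simp: inj_on_def)

text \<open>Seen from a site \<open>y\<close> at depth at least \<open>r\<close>, the shifted window
  still contains \<open>cube r\<close>, so only the tail beyond it is lost. This serves the interior
  sites in the density limit and the translations of condition (III).\<close>

lemma window_sum_close:
  fixes c :: "int ^ 'd \<Rightarrow> complex"
  assumes q: "q > 1" and c: "\<And>z. cmod (c z) \<le> K * wt q z"
    and y: "y \<in> cube l" and m: "l + r \<le> m"
  shows "cmod ((\<Sum>x\<in>cube m. c (x - y)) - infsum c UNIV) \<le> K * wt_tail TYPE('d) q r"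
proof -
  let ?Z = "(\<lambda>x. x - y) ` (cube m :: (int ^ 'd) set)"
  have "cube r \<subseteq> ?Z"
  proof
    fix z :: "int ^ 'd" assume z: "z \<in> cube r"
    have "\<bar>(z + y) $ i\<bar> \<le> int m" for i
    proof -
      have "\<bar>z $ i + y $ i\<bar> \<le> int r + int l"
        using y z abs_triangle_ineq[of "z $ i" "y $ i"] by (smt (verit) cube_def mem_Collect_eq)
      then show ?thesis using m by simp
    qed
    then have "z + y \<in> cube m" by (simp add: cube_def)
    then show "z \<in> ?Z" by (metis add_diff_cancel_right' image_eqI)
  qed
  then have "K * infsum (wt q) (- ?Z) \<le> K * wt_tail TYPE('d) q r"
    by (intro mult_left_mono infsum_wt_compl_le_tail q wt_dominated_const_nonneg[OF c])
  then show ?thesis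
    using wt_dominated_remainder[OF q c finite_imageI[OF finite_cube]]
    unfolding sum_shifted_cube by (rule order_trans[rotated])
qed

text \<open>Sites of \<open>cube m\<close> at depth \<open>r\<close> see the full sum up to its tail; the boundary layer has
  vanishing density.\<close>

lemma cube_average_tendsto:
  fixes c :: "int ^ 'd \<Rightarrow> complex"
  assumes q: "q > 1" and c: "\<And>z. cmod (c z) \<le> K * wt q z"
  shows "(\<lambda>m. (\<Sum>x\<in>cube m. \<Sum>y\<in>cube m. c (x - y)) / of_nat (card (cube m :: (int ^ 'd) set)))
           \<longlonglongrightarrow> infsum c UNIV"
proof (rule LIMSEQ_I)
  fix e :: real assume e: "e > 0"
  let ?N = "\<lambda>m. real (card (cube m :: (int ^ 'd) set))"
  let ?S = "\<lambda>m. \<Sum>x\<in>cube m. \<Sum>y\<in>cube m. c (x - y)"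
  \<comment> \<open>A crude bound on the error valid at every site, including those near the
    boundary where much of the sum may be cut off.\<close>
  define T where "T = K * infsum (wt q :: int ^ 'd \<Rightarrow> real) UNIV"
  have K: "K \<ge> 0" by (rule wt_dominated_const_nonneg[OF c])
  then have T: "T \<ge> 0" by (simp add: T_def infsum_nonneg wt_nonneg)
  have "(\<lambda>r. K * wt_tail TYPE('d) q r) \<longlonglongrightarrow> 0"
    by (rule tendsto_mult_right_zero[OF wt_tail_tendsto[OF q]])
  then obtain r where r: "K * wt_tail TYPE('d) q r < e / 2"
    using e LIMSEQ_D[of _ 0 "e / 2"] by (metis abs_less_iff diff_zero half_gt_zero order_refl real_norm_def)
  \<comment> \<open>The fraction of sites in the boundary layer of width \<open>r\<close> vanishes,
    because the side lengths 2(m - r) + 1 and 2m + 1 have ratio tending to 1.\<close>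
  have ratio: "(\<lambda>m. T * (1 - ?N (m - r) / ?N m)) \<longlonglongrightarrow> 0"
  proof -
    have "(\<lambda>m. 1 - 2 * real r / (2 * real m + 1)) \<longlonglongrightarrow> 1 - 0"
      by (intro tendsto_diff tendsto_const tendsto_divide_0[OF tendsto_const])
        (auto intro!: filterlim_at_top_imp_at_infinity filterlim_tendsto_pos_mult_at_top[OF tendsto_const]
          filterlim_real_sequentially filterlim_at_top_add_at_top filterlim_tendsto_add_at_top[OF tendsto_const]
          simp: add.commute[of _ 1])
    moreover have "\<forall>\<^sub>F m in sequentially. 1 - 2 * real r / (2 * real m + 1)
        = (2 * real (m - r) + 1) / (2 * real m + 1)"
      using eventually_ge_at_top[of r] by eventually_elim (auto simp: of_nat_diff field_simps)
    ultimately have "(\<lambda>m. (2 * real (m - r) + 1) / (2 * real m + 1)) \<longlonglongrightarrow> 1"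
      using tendsto_cong by force
    then have "(\<lambda>m. T * (1 - ((2 * real (m - r) + 1) / (2 * real m + 1)) ^ CARD('d))) \<longlonglongrightarrow> T * (1 - 1 ^ CARD('d))"
      by (intro tendsto_intros)
    then show ?thesis by (simp add: card_cube power_divide add.commute)
  qed
  obtain M where M: "\<And>m. m \<ge> M \<Longrightarrow> T * (1 - ?N (m - r) / ?N m) < e / 2"
    using LIMSEQ_D[OF ratio, of "e / 2"] e by (metis abs_less_iff diff_zero half_gt_zero real_norm_def)
  have "norm (?S m / of_nat (card (cube m :: (int ^ 'd) set)) - infsum c UNIV) < e" if m: "m \<ge> max M r" for m
  proof -
    let ?d = "\<lambda>y. (\<Sum>x\<in>cube m. c (x - y)) - infsum c UNIV"
    let ?C = "cube m :: (int ^ 'd) set" and ?I = "cube (m - r) :: (int ^ 'd) set"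
    have N0: "?N m > 0" using card_cube_pos by simp
    have sub: "?I \<subseteq> ?C" by (rule cube_mono) simp
    have in_b: "cmod (?d y) \<le> e / 2" if "y \<in> ?I" for y
      using window_sum_close[OF q c that, where r = r and m = m] m r by simp
    have out_b: "cmod (?d y) \<le> T" for y
    proof -
      have "cmod (?d y) \<le> K * infsum (wt q) (- ((\<lambda>x. x - y) ` ?C))"
        unfolding sum_shifted_cube by (rule wt_dominated_remainder[OF q c finite_imageI[OF finite_cube]])
      also have "\<dots> \<le> T" unfolding T_def
        by (intro mult_left_mono K infsum_mono2 wt_summable_on q) (auto simp: wt_nonneg)
      finally show ?thesis .
    qed
    \<comment> \<open>The limit is subtracted once for each of the \<open>card ?C\<close> sites, so
      the error becomes an average of errors per site.\<close>
    have "?S m / of_nat (card ?C) - infsum c UNIV = (\<Sum>y\<in>cube m. ?d y) / of_nat (card ?C)"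
      using N0 by (subst sum.swap) (simp add: sum_subtractf field_simps)
    then have "norm (?S m / of_nat (card ?C) - infsum c UNIV) = cmod (\<Sum>y\<in>cube m. ?d y) / ?N m"
      by (simp add: norm_divide)
    also have "cmod (\<Sum>y\<in>cube m. ?d y) \<le> (\<Sum>y\<in>cube m. cmod (?d y))" by (rule norm_sum)
    also have "\<dots> = (\<Sum>y\<in>?I. cmod (?d y)) + (\<Sum>y\<in>?C - ?I. cmod (?d y))"
      using sum.subset_diff[OF sub finite_cube] by (simp add: add.commute)
    also have "\<dots> \<le> ?N (m - r) * (e / 2) + real (card (?C - ?I)) * T"
      by (intro add_mono sum_bounded_above in_b out_b)
    also have "real (card (?C - ?I)) = ?N m - ?N (m - r)"
      using card_mono[OF finite_cube sub] by (simp add: card_Diff_subset[OF finite_cube sub] of_nat_diff)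
    also have "?N (m - r) * (e / 2) \<le> ?N m * (e / 2)"
      using card_mono[OF finite_cube sub] e by (intro mult_right_mono) auto
    finally have "norm (?S m / of_nat (card ?C) - infsum c UNIV)
        \<le> (?N m * (e / 2) + (?N m - ?N (m - r)) * T) / ?N m"
      using N0 by (simp add: divide_right_mono)
    also have "\<dots> = e / 2 + T * (1 - ?N (m - r) / ?N m)" using N0 by (simp add: field_simps)
    also have "\<dots> < e / 2 + e / 2" using m by (intro add_strict_left_mono M) simp
    finally show ?thesis by simp
  qed
  then show "\<exists>no. \<forall>m\<ge>no. norm (?S m / of_nat (card (cube m :: (int ^ 'd) set)) - infsum c UNIV) < e"
    by blast
qed

section \<open>Clustering states\<close>

text \<open>\<open>R\<close> stands for the total radius of the supports and \<open>d\<close> for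
  their distance after a shift by \<open>z\<close>. Distance 0 forces |z| to be at most
  \<open>R\<close>, where \<open>f 0\<close> is absorbed by the constant; for d >= 1 one has 1 + |z|
  <= d (2 + R), so the power law applies.\<close>

lemma decay_le_wt:
  fixes f :: "int \<Rightarrow> real" and z :: "int ^ 'd"
  assumes f_le: "\<And>d. d > 0 \<Longrightarrow> f d \<le> real_of_int d powr (- p)" and p: "p > 0" and R: "R \<ge> 0"
    and d: "d \<ge> 0" "real_of_int (ldist z 0) - R \<le> real_of_int d"
  shows "f d \<le> max (f 0) 1 * (2 + R) powr p * wt (p / real CARD('d)) z"
proof -
  define M where "M = max (f 0) 1 * (2 + R) powr p"
  have M: "(2 + R) powr p \<le> M" unfolding M_def
    using mult_right_mono[of 1 "max (f 0) 1" "(2 + R) powr p"] by simp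
  define n where "n = 1 + real_of_int (ldist z 0)"
  have n: "n \<ge> 1" using ldist_nonneg[of z 0] by (simp add: n_def)
  have "f d \<le> M * n powr (- p)"
  proof (cases "d = 0")
    case True
    have "n \<le> 2 + R" using d True by (simp add: n_def)
    then have "n powr p \<le> (2 + R) powr p" using n p by (intro powr_mono2) auto
    then have "1 \<le> (2 + R) powr p * n powr (- p)"
      using n by (simp add: powr_minus field_simps)
    then have "max (f 0) 1 * 1 \<le> max (f 0) 1 * ((2 + R) powr p * n powr (- p))"
      by (intro mult_left_mono) auto
    then show ?thesis using True by (simp add: M_def mult.assoc)
  next
    case False
    then have d1: "real_of_int d \<ge> 1" using d by linarith
    have "n \<le> 1 + real_of_int d + R" using d by (simp add: n_def)
    also have "\<dots> \<le> real_of_int d * (2 + R)"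
      using d1 mult_right_mono[OF d1 R] by (simp add: distrib_left)
    finally have "n / (2 + R) \<le> real_of_int d" using R by (simp add: pos_divide_le_eq)
    then have "real_of_int d powr (- p) \<le> (n / (2 + R)) powr (- p)"
      using n R p by (intro powr_mono2') auto
    also have "\<dots> = (2 + R) powr p * n powr (- p)"
      using n R by (simp add: powr_divide powr_minus field_simps)
    also have "\<dots> \<le> M * n powr (- p)" by (intro mult_right_mono M) auto
    finally show ?thesis using f_le[of d] False d by simp
  qed
  also have "n powr (- p) \<le> wt (p / real CARD('d)) z"
  proof -
    have "n powr (- p) = (n powr (- (p / real CARD('d)))) ^ CARD('d)"
      using n by (simp add: powr_power)
    also have "\<dots> = (\<Prod>i\<in>(UNIV :: 'd set). n powr (- (p / real CARD('d))))" by simp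
    also have "\<dots> \<le> wt (p / real CARD('d)) z"
      unfolding wt_def
    proof (intro prod_mono conjI powr_mono2')
      show "1 + real_of_int \<bar>z $ i\<bar> \<le> n" for i
        using abs_nth_le_ldist[of z i] by (simp add: n_def)
    qed (use p in auto)
    finally show ?thesis .
  qed
  then have "M * n powr (- p) \<le> M * wt (p / real CARD('d)) z"
    using order_trans[OF powr_ge_zero M] by (intro mult_left_mono)
  finally show ?thesis by (simp add: M_def)
qed

locale clustering =
  fixes sc :: "complex \<Rightarrow> 'a::{real_normed_algebra_1,banach} \<Rightarrow> 'a"
    and st :: "'a \<Rightarrow> 'a"
    and Oloc :: "(int ^ 'd) set \<Rightarrow> 'a set"
    and iota :: "int ^ 'd \<Rightarrow> 'a \<Rightarrow> 'a"
    and om :: "'a \<Rightarrow> complex"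
  assumes quasi_local: "quasi_local sc st Oloc iota"
    and clustering_state: "clustering_state sc st Oloc iota om"
begin

sublocale cstar sc st
  using quasi_local by unfold_locales (simp add: quasi_local_def)

section \<open>Local algebras, supports and translations\<close>

abbreviation Ob :: "'a set" where "Ob \<equiv> Obs Oloc"

lemmas ql = conjunct2[OF quasi_local[unfolded quasi_local_def]]
lemmas ql_Oloc = conjunct1[OF ql, THEN spec, THEN mp]
lemmas ql_regions = conjunct2[OF ql]
lemmas ql_translations = ql_regions[THEN conjunct2, THEN conjunct2, THEN conjunct2, THEN conjunct2, THEN conjunct2]

lemma
  assumes "finite X"
  shows Oloc_subspace: "subspace (Oloc X)"
    and Oloc_finite_dim: "\<exists>B. finite B \<and> B \<subseteq> Oloc X \<and> span B = Oloc X"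
    and Oloc_one: "1 \<in> Oloc X"
    and Oloc_mult: "A \<in> Oloc X \<Longrightarrow> B \<in> Oloc X \<Longrightarrow> A * B \<in> Oloc X"
    and Oloc_st: "A \<in> Oloc X \<Longrightarrow> st A \<in> Oloc X"
  using ql_Oloc[OF assms] by blast+

lemma Oloc_empty: "Oloc {} = range (\<lambda>c. sc c 1)"
  and Oloc_mono: "finite X \<Longrightarrow> finite Y \<Longrightarrow> X \<subseteq> Y \<Longrightarrow> Oloc X \<subseteq> Oloc Y"
  and Oloc_inter: "finite X \<Longrightarrow> finite Y \<Longrightarrow> Oloc X \<inter> Oloc Y = Oloc (X \<inter> Y)"
  by (rule ql_regions[THEN conjunct1])
    (rule ql_regions[THEN conjunct2, THEN conjunct1, rule_format], assumption+,
     rule ql_regions[THEN conjunct2, THEN conjunct2, THEN conjunct1, rule_format], assumption+)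

lemma iota_automorphism: "star_automorphism sc st (iota x)"
  and iota_comp: "iota x \<circ> iota y = iota (x + y)"
  and iota_Obs: "A \<in> Ob \<Longrightarrow> iota x A \<in> Ob"
  and supp_iota: "A \<in> Ob \<Longrightarrow> supp Oloc (iota x A) = (\<lambda>y. y + x) ` supp Oloc A"
  using ql_translations by blast+

lemma Oloc_add: "finite X \<Longrightarrow> A \<in> Oloc X \<Longrightarrow> B \<in> Oloc X \<Longrightarrow> A + B \<in> Oloc X"
  and Oloc_sc: "finite X \<Longrightarrow> A \<in> Oloc X \<Longrightarrow> sc c A \<in> Oloc X"
  and Oloc_zero: "finite X \<Longrightarrow> 0 \<in> Oloc X"
  by (rule subspace_add[OF Oloc_subspace], assumption+, rule subspace_scale[OF Oloc_subspace],
      assumption+, rule subspace_0[OF Oloc_subspace])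

lemma Oloc_sum:
  assumes "finite X" "\<And>i. i \<in> I \<Longrightarrow> g i \<in> Oloc X"
  shows "sum g I \<in> Oloc X"
  using assms(2)
  by (induction I rule: infinite_finite_induct) (auto simp: Oloc_zero Oloc_add assms(1))

lemma Obs_lball: "A \<in> Ob \<longleftrightarrow> (\<exists>R. A \<in> Oloc (lball (real R)))"
proof
  assume "A \<in> Ob"
  then obtain X where X: "finite X" "A \<in> Oloc X" by (auto simp: Obs_def)
  obtain R where "X \<subseteq> lball (real R)" using finite_subset_lball[OF X(1)] by blast
  then show "\<exists>R. A \<in> Oloc (lball (real R))" using Oloc_mono[OF X(1) finite_lball] X(2) by blast
qed (unfold Obs_def, use finite_lball in blast)

lemma Obs_common:
  assumes "A \<in> Ob" "B \<in> Ob" obtains R where "A \<in> Oloc (lball (real R))" "B \<in> Oloc (lball (real R))"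
proof -
  obtain R1 R2 where R: "A \<in> Oloc (lball (real R1))" "B \<in> Oloc (lball (real R2))"
    using assms Obs_lball by blast
  have "Oloc (lball (real R)) \<subseteq> Oloc (lball (real (max R1 R2)))" if "R \<le> max R1 R2" for R
    using that by (intro Oloc_mono finite_lball lball_mono) simp
  then show ?thesis using that[of "max R1 R2"] R by (meson max.cobounded1 max.cobounded2 subsetD)
qed

lemma Obs_add: "A \<in> Ob \<Longrightarrow> B \<in> Ob \<Longrightarrow> A + B \<in> Ob"
  by (metis Obs_common Obs_lball Oloc_add finite_lball)

lemma Obs_sc: "A \<in> Ob \<Longrightarrow> sc c A \<in> Ob"
  by (metis Obs_lball Oloc_sc finite_lball)

lemma Obs_zero: "0 \<in> Ob"
  by (metis Obs_lball Oloc_zero finite_lball)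

lemma Obs_st: "A \<in> Ob \<Longrightarrow> st A \<in> Ob"
  by (metis Obs_lball Oloc_st finite_lball)

lemma supp_subset: "finite X \<Longrightarrow> A \<in> Oloc X \<Longrightarrow> supp Oloc A \<subseteq> X"
  by (auto simp: supp_def)

text \<open>A region of least cardinality lies inside every other admissible region, since their
  intersection is again admissible by the intersection property of local algebras.\<close>

lemma supp_attained:
  assumes "A \<in> Ob" shows "finite (supp Oloc A)" "A \<in> Oloc (supp Oloc A)"
proof -
  let ?P = "\<lambda>X. finite X \<and> A \<in> Oloc X"
  have "\<exists>X. ?P X" using assms by (auto simp: Obs_def)
  then obtain X where X: "?P X" and least: "\<And>Y. ?P Y \<Longrightarrow> card X \<le> card Y"
    using ex_has_least_nat[of ?P _ card] by blast
  have "X \<subseteq> Y" if Y: "?P Y" for Y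
  proof -
    have "?P (X \<inter> Y)" using X Y Oloc_inter by blast
    then have "X \<inter> Y = X" using least X card_seteq[of X "X \<inter> Y"] by blast
    then show ?thesis by blast
  qed
  then have "supp Oloc A = X" using X by (auto simp: supp_def)
  then show "finite (supp Oloc A)" "A \<in> Oloc (supp Oloc A)" using X by auto
qed

lemma iota_mult: "iota x (A * B) = iota x A * iota x B"
  and iota_st: "iota x (st A) = st (iota x A)"
  using iota_automorphism[of x] by (simp_all add: star_automorphism_def)

lemma iota_iota: "iota x (iota y A) = iota (x + y) A"
  using iota_comp[of x y] by (metis comp_apply)

text \<open>By the composition law \<open>iota 0\<close> is idempotent, and an injective idempotent
  map is the identity.\<close>

lemma iota_0: "iota 0 A = A"
proof -
  have "iota 0 (iota 0 A) = iota 0 A" by (simp add: iota_iota)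
  moreover have "inj (iota 0)"
    using iota_automorphism[of 0] by (auto simp: star_automorphism_def bij_def)
  ultimately show ?thesis by (simp add: inj_eq)
qed

text \<open>\<open>star_automorphism\<close> is purely algebraic, so the norm bound comes from
  finite dimension of a local algebra containing \<open>A\<close>. It keeps the clustering estimate
  uniform over all translates.\<close>

lemma norm_iota_le:
  assumes "A \<in> Ob" shows "norm (iota x A) \<le> norm A"
proof -
  obtain X where X: "finite X" "A \<in> Oloc X" using assms by (auto simp: Obs_def)
  obtain B where "finite B" "span B = Oloc X" using Oloc_finite_dim[OF X(1)] by blast
  then show ?thesis
    using star_automorphism_contractive[OF iota_automorphism, of B A x] X
    by (simp add: Oloc_one Oloc_mult Oloc_st)
qed

text \<open>Covariance is given for supports; it passes to regions because an observable belongs to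
  the algebra of its support.\<close>

lemma iota_Oloc:
  assumes "finite X" "A \<in> Oloc X" shows "iota x A \<in> Oloc ((\<lambda>y. y + x) ` X)"
proof -
  have A: "A \<in> Ob" using assms by (auto simp: Obs_def)
  have "iota x A \<in> Oloc ((\<lambda>y. y + x) ` supp Oloc A)"
    using supp_attained(2)[OF iota_Obs[OF A]] by (simp add: supp_iota[OF A])
  also have "\<dots> \<subseteq> Oloc ((\<lambda>y. y + x) ` X)"
    using supp_subset[OF assms] assms(1) supp_attained(1)[OF A] by (intro Oloc_mono) auto
  finally show ?thesis .
qed

section \<open>The state and its GNS form\<close>

lemma state: "is_state sc st om"
  and om_iota: "om (iota x A) = om A"
  using clustering_state by (simp_all add: clustering_state_def)

lemma om_add: "om (A + B) = om A + om B"
  and om_sc: "om (sc c A) = c * om A"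
  and om_real: "Im (om (st A * A)) = 0"
  and om_pos: "0 \<le> Re (om (st A * A))"
  and om_one: "om 1 = 1"
  using state by (simp_all add: is_state_def)

lemma om_zero: "om 0 = 0"
  using om_add[of 0 0] by simp

lemma om_diff: "om (A - B) = om A - om B"
  using om_add[of "A - B" B] by simp

lemma om_sum: "om (sum g I) = (\<Sum>i\<in>I. om (g i))"
  by (induction I rule: infinite_finite_induct) (auto simp: om_zero om_add)

text \<open>Hermiticity from positivity: adding \<open>c\<close> times the unit to \<open>A\<close>,
  reality of the state on squares yields the imaginary part for c = 1 and the real part for c =
  i.\<close>

lemma om_st: "om (st A) = cnj (om A)"
proof -
  have e: "om (st (A + sc c 1) * (A + sc c 1))
      = om (st A * A) + c * om (st A) + cnj c * om A + cnj c * c" for c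
    by (simp add: st_add st_sc st_one distrib_left distrib_right sc_mult_left sc_mult_right om_add om_sc om_one)
  have "Im (om (st A)) + Im (om A) = 0"
    using om_real[of "A + sc 1 1"] om_real[of A] unfolding e by simp
  moreover have "Re (om (st A)) - Re (om A) = 0"
    using om_real[of "A + sc \<i> 1"] om_real[of A] unfolding e by simp
  ultimately show ?thesis by (simp add: complex_eq_iff)
qed

sublocale gns: positive_form sc UNIV "\<lambda>A B. om (st A * B)"
proof unfold_locales
  show "om (st y * x) = cnj (om (st x * y))" for x y
    using om_st[of "st x * y"] by (simp add: st_mult st_st)
qed (auto simp: distrib_left om_add sc_mult_right om_sc om_pos)

section \<open>Connected correlations and their decay\<close>

definition corr :: "'a \<Rightarrow> 'a \<Rightarrow> int ^ 'd \<Rightarrow> complex" where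
  "corr a b z = om (st (iota z a) * b) - om (st a) * om b"

lemma corr_translated: "om (st (iota x a) * iota y b) - om (st a) * om b = corr a b (x - y)"
proof -
  have "st (iota x a) * iota y b = iota y (st (iota (x - y) a) * b)"
    by (simp add: iota_mult iota_st iota_iota)
  then show ?thesis by (simp add: corr_def om_iota)
qed

lemma corr_scalar_right: "corr a (sc c 1) z = 0"
  by (simp add: corr_def sc_mult_right om_sc om_one flip: iota_st) (simp add: om_iota)

text \<open>The order of quantifiers matters: \<open>K\<close> is chosen before \<open>b\<close>,
  from \<open>a\<close> and the radius \<open>R\<close> alone. This uniformity is what makes the
  diagonal construction of a charge possible.\<close>

lemma clustering_decay:
  "\<exists>q>1. \<forall>a\<in>Ob. \<forall>R. \<exists>K\<ge>0. \<forall>b\<in>Oloc (lball (real R)). \<forall>z. cmod (corr a b z) \<le> K * norm b * wt q z"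
proof -
  obtain \<nu> :: "nat \<Rightarrow> real" and f :: "int \<Rightarrow> real" and p :: real
    where \<nu>: "\<And>l. \<nu> l > 0" and f: "\<And>d. f d > 0" and p: "p > real CARD('d)"
      and f_le: "\<And>d. d > 0 \<Longrightarrow> f d \<le> real_of_int d powr (- p)"
      and cl: "\<And>l A B. A \<in> Ob \<Longrightarrow> B \<in> Ob \<Longrightarrow> card (supp Oloc A) < l \<Longrightarrow> card (supp Oloc B) < l \<Longrightarrow>
            supp Oloc A \<noteq> {} \<Longrightarrow> supp Oloc B \<noteq> {} \<Longrightarrow>
            cmod (om (A * B) - om A * om B) \<le> \<nu> l * norm A * norm B * f (distO Oloc A B)"
    using clustering_state unfolding clustering_state_def by blast
  define q where "q = p / real CARD('d)"
  have q: "q > 1" using p by (simp add: q_def)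
  have p0: "p > 0" using p by (metis of_nat_0_le_iff order_le_less_trans)
  have "\<exists>K\<ge>0. \<forall>b\<in>Oloc (lball (real R)). \<forall>z. cmod (corr a b z) \<le> K * norm b * wt q z"
    if a: "a \<in> Ob" for a R
  proof -
    obtain R1 where R1: "a \<in> Oloc (lball (real R1))" using a Obs_lball by blast
    define R0 where "R0 = real R1 + real R"
    \<comment> \<open>One bound for both supports: that of \<open>b\<close> is at most a whole ball,
      taking the star and translating do not enlarge that of \<open>a\<close>, and the 1 makes the
      inequalities strict.\<close>
    define l where "l = card (supp Oloc a) + card (lball (real R) :: (int ^ 'd) set) + 1"
    define M where "M = max (f 0) 1 * (2 + R0) powr p"
    define K where "K = \<nu> l * norm a * M"
    have M: "M \<ge> 0" by (simp add: M_def)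
    have K: "K \<ge> 0" using \<nu>[of l] M by (simp add: K_def)
    have decay: "f d \<le> M * wt q z" if "d \<ge> 0" "real_of_int (ldist z 0) - R0 \<le> real_of_int d"
      for d and z :: "int ^ 'd"
      unfolding M_def q_def using that by (intro decay_le_wt[OF f_le p0]) (auto simp: R0_def)
    have "cmod (corr a b z) \<le> K * norm b * wt q z" if b: "b \<in> Oloc (lball (real R))" for b z
    proof -
      define A where "A = st (iota z a)"
      have bO: "b \<in> Ob" using b Obs_lball by blast
      have AO: "A \<in> Ob" using a by (simp add: A_def iota_Obs Obs_st)
      have A_iota: "A = iota z (st a)" by (simp add: A_def iota_st)
      have corr: "corr a b z = om (A * b) - om A * om b"
        by (simp add: corr_def A_def flip: iota_st) (simp add: om_iota)
      have suppb: "supp Oloc b \<subseteq> lball (real R)" by (rule supp_subset[OF finite_lball b])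
      have sta: "supp Oloc (st a) \<subseteq> supp Oloc a"
        using supp_attained[OF a] by (intro supp_subset Oloc_st)
      have suppA: "supp Oloc A = (\<lambda>y. y + z) ` supp Oloc (st a)"
        unfolding A_iota by (rule supp_iota[OF Obs_st[OF a]])
      show ?thesis
      proof (cases "supp Oloc A = {} \<or> supp Oloc b = {}")
        case True
        \<comment> \<open>Clustering speaks of nonempty supports only; an empty support means a
          multiple of the unit, whose connected correlations vanish.\<close>
        have "corr a b z = 0"
        proof (cases "supp Oloc A = {}")
          case True
          then obtain c where "A = sc c 1" using supp_attained(2)[OF AO] Oloc_empty by auto
          then show ?thesis unfolding corr by (simp add: sc_mult_left om_sc om_one)
        next
          case False
          then obtain c where "b = sc c 1"
            using True supp_attained(2)[OF bO] Oloc_empty by auto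
          then show ?thesis by (simp add: corr_scalar_right)
        qed
        then show ?thesis using K wt_nonneg[of q z] by simp
      next
        case False
        let ?D = "{ldist x y | x y. x \<in> supp Oloc A \<and> y \<in> supp Oloc b}"
        have D_eq: "?D = (\<lambda>(x, y). ldist x y) ` (supp Oloc A \<times> supp Oloc b)" by auto
        have "Min ?D \<in> ?D"
          using False supp_attained(1)[OF AO] supp_attained(1)[OF bO]
          by (intro Min_in) (auto simp: D_eq)
        then obtain x y where xy: "distO Oloc A b = ldist x y" "x \<in> supp Oloc A" "y \<in> supp Oloc b"
          unfolding distO_def by blast
        obtain x' where x': "x = x' + z" "x' \<in> supp Oloc (st a)" using xy(2) suppA by blast
        have x'R: "real_of_int (ldist x' 0) \<le> real R1"
          using x'(2) sta supp_subset[OF finite_lball R1] by (auto simp: lball_def)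
        have yR: "real_of_int (ldist y 0) \<le> real R"
          using xy(3) suppb by (auto simp: lball_def)
        \<comment> \<open>Route from \<open>z\<close> to the origin through the nearest pair of
          support points: the outer legs are bounded by the two radii, so the distance of the
          supports is at least |z| - \<open>R0\<close>.\<close>
        have "ldist z 0 \<le> ldist z x + ldist x y + ldist y 0"
          using ldist_triangle[of z 0 x] ldist_triangle[of x 0 y] by simp
        also have "ldist z x = ldist x' 0"
          using ldist_translate[of 0 z x'] by (simp add: x'(1) ldist_commute)
        finally have "real_of_int (ldist z 0) \<le> real_of_int (ldist x' 0) + real_of_int (ldist x y) + real_of_int (ldist y 0)"
          by linarith
        then have "f (distO Oloc A b) \<le> M * wt q z"
          using x'R yR by (intro decay) (auto simp: xy(1) ldist_nonneg R0_def)
        moreover have "norm A \<le> norm a"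
          using norm_iota_le[OF a] by (simp add: A_def norm_st)
        ultimately have "\<nu> l * norm A * norm b * f (distO Oloc A b) \<le> \<nu> l * norm a * norm b * (M * wt q z)"
          using \<nu>[of l] f[of "distO Oloc A b"] by (intro mult_mono) auto
        moreover have "card (supp Oloc A) < l"
        proof -
          have "card (supp Oloc A) \<le> card (supp Oloc (st a))"
            unfolding suppA by (rule card_image_le) (rule supp_attained[OF Obs_st[OF a]])
          also have "\<dots> \<le> card (supp Oloc a)" by (rule card_mono[OF supp_attained(1)[OF a] sta])
          finally show ?thesis by (simp add: l_def)
        qed
        moreover have "card (supp Oloc b) < l"
          using card_mono[OF finite_lball suppb] by (simp add: l_def)
        ultimately have "cmod (corr a b z) \<le> \<nu> l * norm a * norm b * (M * wt q z)"
          unfolding corr using cl[OF AO bO, of l] False by linarith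
        then show ?thesis by (simp add: K_def algebra_simps)
      qed
    qed
    then show ?thesis using K by blast
  qed
  then show ?thesis using q by blast
qed

text \<open>One exponent fixed for the whole locale, so that all correlations are compared with the
  same summable weight.\<close>

definition decay :: real where
  "decay = (SOME q. q > 1 \<and> (\<forall>a\<in>Ob. \<forall>R. \<exists>K\<ge>0. \<forall>b\<in>Oloc (lball (real R)). \<forall>z.
     cmod (corr a b z) \<le> K * norm b * wt q z))"

lemma decay: "decay > 1"
  and corr_bound_uniform: "a \<in> Ob \<Longrightarrow> \<exists>K\<ge>0. \<forall>b\<in>Oloc (lball (real R)). \<forall>z. cmod (corr a b z) \<le> K * norm b * wt decay z"
proof -
  have "decay > 1 \<and> (\<forall>a\<in>Ob. \<forall>R. \<exists>K\<ge>0. \<forall>b\<in>Oloc (lball (real R)). \<forall>z.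
     cmod (corr a b z) \<le> K * norm b * wt decay z)"
    unfolding decay_def by (rule someI_ex) (use clustering_decay in blast)
  then show "decay > 1"
    "a \<in> Ob \<Longrightarrow> \<exists>K\<ge>0. \<forall>b\<in>Oloc (lball (real R)). \<forall>z. cmod (corr a b z) \<le> K * norm b * wt decay z"
    by blast+
qed

lemma corr_bound:
  assumes "a \<in> Ob" "b \<in> Ob" obtains K where "\<And>z. cmod (corr a b z) \<le> K * wt decay z"
  using assms Obs_lball corr_bound_uniform by metis

lemma corr_summable: "a \<in> Ob \<Longrightarrow> b \<in> Ob \<Longrightarrow> corr a b summable_on UNIV"
  by (metis abs_summable_summable corr_bound decay wt_dominated_summable)

lemma ipw_eq_infsum: "ipw st iota om a b = infsum (corr a b) UNIV"
  by (simp add: ipw_def corr_def[abs_def])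

lemma ipw_add: "a \<in> Ob \<Longrightarrow> b \<in> Ob \<Longrightarrow> c \<in> Ob \<Longrightarrow>
    ipw st iota om a (b + c) = ipw st iota om a b + ipw st iota om a c"
  unfolding ipw_eq_infsum
  by (subst infsum_add[symmetric])
    (auto intro!: corr_summable infsum_cong simp: corr_def distrib_left om_add)

lemma ipw_sc: "ipw st iota om a (sc c b) = c * ipw st iota om a b"
  unfolding ipw_eq_infsum infsum_cmult_right'[symmetric]
  by (intro infsum_cong) (simp add: corr_def sc_mult_right om_sc right_diff_distrib)

lemma corr_uminus: "corr b a (- z) = cnj (corr a b z)"
proof -
  have "corr b a (- z) = om (st b * iota z a) - om (st b) * om a"
    using corr_translated[of 0 b z a] by (simp add: iota_0)
  also have "om (st b * iota z a) = cnj (om (st (iota z a) * b))" by (rule gns.F_herm) auto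
  finally show ?thesis by (simp add: corr_def om_st mult.commute)
qed

lemma ipw_herm: "ipw st iota om b a = cnj (ipw st iota om a b)"
proof -
  have "infsum (corr b a) UNIV = infsum (\<lambda>z. corr b a (- z)) UNIV"
    by (rule infsum_reindex_bij_betw[symmetric]) (simp add: bij_uminus)
  then show ?thesis by (simp add: ipw_eq_infsum corr_uminus)
qed

section \<open>Block sums and positivity of the form\<close>

definition centre :: "'a \<Rightarrow> 'a" where "centre a = a - sc (om a) 1"

text \<open>Centring the left factor alone subtracts the product of means; the right factor may then
  be centred or not at will.\<close>

lemma centre_covariance: "om (st (centre a) * b) = om (st a * b) - om (st a) * om b"
  by (simp add: centre_def st_diff st_sc st_one left_diff_distrib sc_mult_left om_diff om_sc om_st)

lemma om_st_centre: "om (st (centre a)) = 0"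
  using centre_covariance[of a 1] by (simp add: om_one)

lemma centre_variance: "om (st (centre a) * centre a) = om (st a * a) - om (st a) * om a"
proof -
  have "om (st (centre a) * (a - sc (om a) 1)) = om (st a * a) - om (st a) * om a"
    by (simp only: right_diff_distrib om_diff centre_covariance sc_mult_right om_sc om_one mult_1_right om_st_centre) simp
  then show ?thesis by (simp only: centre_def[of a, symmetric])
qed

definition blk :: "nat \<Rightarrow> 'a \<Rightarrow> 'a" where "blk m a = (\<Sum>x\<in>cube m. iota x a)"

text \<open>Against a single translate, a block sum sees a window of the correlation sum, which is
  the situation of \<open>window_sum_close\<close>.\<close>

lemma blk_covariance: "om (st (centre (blk m a)) * iota y b) = (\<Sum>x\<in>cube m. corr a b (x - y))"
proof -
  have "om (st (blk m a) * iota y b) = (\<Sum>x\<in>cube m. om (st (iota x a) * iota y b))"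
    by (simp add: blk_def st_sum sum_distrib_right om_sum)
  moreover have "om (st (blk m a)) * om (iota y b) = (\<Sum>x\<in>(cube m :: (int ^ 'd) set). om (st a) * om b)"
    by (simp add: blk_def st_sum om_sum sum_distrib_right om_iota flip: iota_st)
  ultimately show ?thesis
    by (simp only: centre_covariance sum_subtractf[symmetric] corr_translated)
qed

lemma blk_variance:
  "om (st (centre (blk m a)) * centre (blk m a)) = (\<Sum>x\<in>cube m. \<Sum>y\<in>cube m. corr a a (x - y))"
proof -
  have "om (st (centre (blk m a)) * centre (blk m a)) = om (st (centre (blk m a)) * blk m a)"
    by (rule trans[OF centre_variance centre_covariance[symmetric]])
  also have "\<dots> = om (st (centre (blk m a)) * (\<Sum>y\<in>cube m. iota y a))" by (simp only: blk_def)
  also have "\<dots> = (\<Sum>y\<in>cube m. om (st (centre (blk m a)) * iota y a))"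
    by (simp only: sum_distrib_left om_sum)
  also have "\<dots> = (\<Sum>y\<in>cube m. \<Sum>x\<in>cube m. corr a a (x - y))" by (simp add: blk_covariance)
  finally show ?thesis by (subst sum.swap)
qed

text \<open>The bridge between the GNS seminorm and that of the completion. It gives positivity of
  \<open>ipw\<close>, the bound on a given charge, and the variance bound (I) for a constructed
  one.\<close>

lemma blk_variance_density:
  assumes "a \<in> Ob"
  shows "(\<lambda>m. Re (om (st (centre (blk m a)) * centre (blk m a))) / real (card (cube m :: (int ^ 'd) set)))
           \<longlonglongrightarrow> Re (ipw st iota om a a)"
proof -
  obtain K where "\<And>z. cmod (corr a a z) \<le> K * wt decay z" using corr_bound[OF assms assms] by blast
  from tendsto_Re[OF cube_average_tendsto[OF decay this]] show ?thesis
    by (simp add: blk_variance ipw_eq_infsum)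
qed

lemma ipw_pos: "a \<in> Ob \<Longrightarrow> 0 \<le> Re (ipw st iota om a a)"
  by (rule LIMSEQ_le_const[OF blk_variance_density]) (auto intro!: divide_nonneg_nonneg om_pos)

sublocale hil: positive_form sc Ob "ipw st iota om"
  by unfold_locales (auto simp: Obs_add Obs_sc Obs_zero ipw_add ipw_sc ipw_pos intro: ipw_herm)

section \<open>The completion as classes of Cauchy sequences\<close>

lemma hcauchy_eq: "hcauchy Oloc st iota om s \<longleftrightarrow> hil.scauchy s"
proof -
  have e: "cmod (ipw st iota om x x) = (hil.sn x)\<^sup>2" if "x \<in> Ob" for x
    using that by (simp add: hil.cmod_F_self hil.sn_sq)
  show ?thesis
  proof (cases "\<forall>n. s n \<in> Ob")
    case True
    let ?d = "\<lambda>m n. hil.sn (s m - s n)"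
    have d0: "0 \<le> ?d m n" for m n using True by (simp add: hil.S_diff hil.sn_nonneg)
    have "(\<forall>e>0. \<exists>N. \<forall>m\<ge>N. \<forall>n\<ge>N. (?d m n)\<^sup>2 < e) \<longleftrightarrow> (\<forall>e>0. \<exists>N. \<forall>m\<ge>N. \<forall>n\<ge>N. ?d m n < e)"
    proof (intro iffI allI impI)
      fix e :: real assume "\<forall>e>0. \<exists>N. \<forall>m\<ge>N. \<forall>n\<ge>N. (?d m n)\<^sup>2 < e" "e > 0"
      then have "\<exists>N. \<forall>m\<ge>N. \<forall>n\<ge>N. (?d m n)\<^sup>2 < e\<^sup>2" by simp
      then show "\<exists>N. \<forall>m\<ge>N. \<forall>n\<ge>N. ?d m n < e" using \<open>e > 0\<close> by (meson less_imp_le power2_less_imp_less)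
    next
      fix e :: real assume "\<forall>e>0. \<exists>N. \<forall>m\<ge>N. \<forall>n\<ge>N. ?d m n < e" "e > 0"
      then have "\<exists>N. \<forall>m\<ge>N. \<forall>n\<ge>N. ?d m n < sqrt e" by simp
      then show "\<exists>N. \<forall>m\<ge>N. \<forall>n\<ge>N. (?d m n)\<^sup>2 < e" using d0 \<open>e > 0\<close>
        by (metis real_sqrt_less_iff real_sqrt_unique)
    qed
    then show ?thesis using True by (simp add: hcauchy_def hil.scauchy_def e hil.S_diff)
  qed (auto simp: hcauchy_def hil.scauchy_def)
qed

text \<open>The relation is defined through the squared seminorm; passing to \<open>sn\<close> makes
  the triangle inequality available for transitivity.\<close>

lemma hrel_eq: "(s, t) \<in> hrel Oloc st iota om \<longleftrightarrow>
    hil.scauchy s \<and> hil.scauchy t \<and> (\<lambda>n. hil.sn (s n - t n)) \<longlonglongrightarrow> 0"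
proof (cases "hil.scauchy s \<and> hil.scauchy t")
  case True
  then have d: "s n - t n \<in> Ob" for n by (simp add: hil.scauchy_def hil.S_diff)
  have e: "ipw st iota om (s n - t n) (s n - t n) = complex_of_real ((hil.sn (s n - t n))\<^sup>2)" for n
    using hil.F_self[OF d] by (simp add: hil.sn_sq[OF d])
  have "(\<lambda>n. ipw st iota om (s n - t n) (s n - t n)) \<longlonglongrightarrow> 0 \<longleftrightarrow> (\<lambda>n. (hil.sn (s n - t n))\<^sup>2) \<longlonglongrightarrow> 0"
    unfolding e
    using tendsto_of_real_iff[of "\<lambda>n. (hil.sn (s n - t n))\<^sup>2" 0 sequentially, where ?'a = complex]
    by (simp only: of_real_0)
  also have "\<dots> \<longleftrightarrow> (\<lambda>n. hil.sn (s n - t n)) \<longlonglongrightarrow> 0"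
  proof
    assume "(\<lambda>n. (hil.sn (s n - t n))\<^sup>2) \<longlonglongrightarrow> 0"
    then have "(\<lambda>n. sqrt ((hil.sn (s n - t n))\<^sup>2)) \<longlonglongrightarrow> sqrt 0" by (rule tendsto_real_sqrt)
    then show "(\<lambda>n. hil.sn (s n - t n)) \<longlonglongrightarrow> 0" using hil.sn_nonneg[OF d] by simp
  next
    assume "(\<lambda>n. hil.sn (s n - t n)) \<longlonglongrightarrow> 0"
    from tendsto_power[OF this, of 2] show "(\<lambda>n. (hil.sn (s n - t n))\<^sup>2) \<longlonglongrightarrow> 0" by simp
  qed
  finally show ?thesis using True by (simp add: hrel_def hcauchy_eq)
qed (auto simp: hrel_def hcauchy_eq)

lemma equiv_hrel: "equiv {s. hcauchy Oloc st iota om s} (hrel Oloc st iota om)"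
proof (rule equivI)
  have S: "s n \<in> Ob" if "hil.scauchy s" for s n using that by (simp add: hil.scauchy_def)
  show "hrel Oloc st iota om \<subseteq> {s. hcauchy Oloc st iota om s} \<times> {s. hcauchy Oloc st iota om s}"
    by (auto simp: hrel_def)
  show "refl_on {s. hcauchy Oloc st iota om s} (hrel Oloc st iota om)"
    using hil.sn_scale[OF Obs_zero, of 0] by (auto simp: refl_on_def hrel_eq hcauchy_eq)
  show "sym (hrel Oloc st iota om)"
    by (rule symI) (auto simp: hrel_eq hil.sn_minus_commute S)
  show "trans (hrel Oloc st iota om)"
  proof (rule transI)
    fix s t u assume "(s, t) \<in> hrel Oloc st iota om" "(t, u) \<in> hrel Oloc st iota om"
    then have c: "hil.scauchy s" "hil.scauchy t" "hil.scauchy u"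
      and l: "(\<lambda>n. hil.sn (s n - t n)) \<longlonglongrightarrow> 0" "(\<lambda>n. hil.sn (t n - u n)) \<longlonglongrightarrow> 0"
      by (auto simp: hrel_eq)
    have "(\<lambda>n. hil.sn (s n - t n) + hil.sn (t n - u n)) \<longlonglongrightarrow> 0"
      using tendsto_add[OF l] by simp
    then have "(\<lambda>n. hil.sn (s n - u n)) \<longlonglongrightarrow> 0"
      by (rule real_tendsto_sandwich[OF _ _ tendsto_const, rotated 2])
        (intro always_eventually allI hil.sn_nonneg hil.S_diff hil.sn_triangle_diff S c)+
    then show "(s, u) \<in> hrel Oloc st iota om" using c by (simp add: hrel_eq)
  qed
qed

end

section \<open>Pseudolocal charges are bounded\<close>

context clustering
begin

lemma centred_eq_centre: "centred sc om Q n = centre (Q n)"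
  by (simp add: centred_def centre_def)

lemma left_charge_tendsto:
  assumes "pseudolocal sc st Oloc iota om Q" "A \<in> Ob"
  shows "(\<lambda>n. om (st (centre (Q n)) * A)) \<longlonglongrightarrow> left_charge sc st Oloc om Q A"
proof -
  have "convergent (\<lambda>n. om (st (centre (Q n)) * A))"
    using assms by (simp add: pseudolocal_def centred_eq_centre)
  then show ?thesis using assms(2) by (simp add: left_charge_def centred_eq_centre convergent_LIMSEQ_iff)
qed

lemma left_charge_add:
  assumes "pseudolocal sc st Oloc iota om Q" "A \<in> Ob" "B \<in> Ob"
  shows "left_charge sc st Oloc om Q (A + B) = left_charge sc st Oloc om Q A + left_charge sc st Oloc om Q B"
proof (rule LIMSEQ_unique[OF left_charge_tendsto[OF assms(1) Obs_add[OF assms(2,3)]]])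
  show "(\<lambda>n. om (st (centre (Q n)) * (A + B))) \<longlonglongrightarrow>
      left_charge sc st Oloc om Q A + left_charge sc st Oloc om Q B"
    using tendsto_add[OF left_charge_tendsto[OF assms(1,2)] left_charge_tendsto[OF assms(1,3)]]
    by (simp add: distrib_left om_add)
qed

lemma left_charge_sc:
  assumes "pseudolocal sc st Oloc iota om Q" "A \<in> Ob"
  shows "left_charge sc st Oloc om Q (sc c A) = c * left_charge sc st Oloc om Q A"
proof (rule LIMSEQ_unique[OF left_charge_tendsto[OF assms(1) Obs_sc[OF assms(2)]]])
  show "(\<lambda>n. om (st (centre (Q n)) * sc c A)) \<longlonglongrightarrow> c * left_charge sc st Oloc om Q A"
    using tendsto_mult_left[OF left_charge_tendsto[OF assms], of c]
    by (simp add: sc_mult_right om_sc)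
qed

lemma left_charge_bounded:
  assumes P: "pseudolocal sc st Oloc iota om Q"
  shows "\<exists>C. \<forall>A\<in>Ob. cmod (left_charge sc st Oloc om Q A) \<le> C * hil.sn A"
proof -
  obtain \<gamma> where \<gamma>: "\<gamma> > 0"
    "\<And>n. n > 0 \<Longrightarrow> Re (om (st (centre (Q n)) * centre (Q n))) \<le> \<gamma> * real n ^ CARD('d)"
    using P by (auto simp: pseudolocal_def centred_eq_centre)
  let ?g = "\<lambda>A n x. om (st (centre (Q n)) * iota x A)"
  obtain k where k: "0 < k" "k < 1" and
    max0: "\<And>A. A \<in> Ob \<Longrightarrow> (\<lambda>n. Max ((\<lambda>(x, y). cmod (?g A n x - ?g A n y))
        ` (lball (k * real n) \<times> lball (k * real n)))) \<longlonglongrightarrow> 0"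
    using P by (auto simp: pseudolocal_def centred_eq_centre)
  define D where "D = real CARD('d)"
  have D: "D \<ge> 1" by (simp add: D_def Suc_le_eq)
  \<comment> \<open>The largest cube with \<open>D * m n\<close> at most \<open>k * n\<close>: it
    fits into the ball in which condition (III) compares translates.\<close>
  define m where "m n = nat \<lfloor>k * real n / D\<rfloor>" for n
  let ?N = "\<lambda>n. real (card (cube (m n) :: (int ^ 'd) set))"
  have m_le: "D * real (m n) \<le> k * real n" for n
  proof -
    have "real (m n) \<le> k * real n / D" using k D by (simp add: m_def)
    then show ?thesis using D by (simp add: field_simps)
  qed
  have m_ge: "k * real n / D \<le> real (m n) + 1" for n
  proof -
    have "0 \<le> k * real n / D" using k D by simp
    then show ?thesis unfolding m_def by linarith
  qed
  have m_lim: "filterlim m sequentially sequentially"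
  proof -
    have "filterlim (\<lambda>n. k / D * real n) at_top sequentially"
      using k D by (intro filterlim_tendsto_pos_mult_at_top[OF tendsto_const] filterlim_real_sequentially) auto
    then have "filterlim (\<lambda>n. - 1 + k / D * real n) at_top sequentially"
      by (intro filterlim_tendsto_add_at_top[OF tendsto_const])
    then have "filterlim (\<lambda>n. real (m n)) at_top sequentially"
      by (rule filterlim_at_top_mono) (use m_ge in \<open>auto simp: algebra_simps\<close>)
    then show ?thesis
      by (simp add: filterlim_sequentially_iff_filterlim_real)
  qed
  have N0: "?N n > 0" for n using card_cube_pos by simp
  have ratio: "real n ^ CARD('d) / ?N n \<le> (D / k) ^ CARD('d)" for n
  proof -
    have "real n \<le> D / k * (real (m n) + 1)"
      using m_ge[of n] k D by (simp add: field_simps)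
    also have "\<dots> \<le> D / k * (2 * real (m n) + 1)"
      using k D by (intro mult_left_mono) auto
    finally have "real n ^ CARD('d) \<le> (D / k * (2 * real (m n) + 1)) ^ CARD('d)"
      by (intro power_mono) auto
    also have "\<dots> = (D / k) ^ CARD('d) * ?N n" by (simp add: card_cube power_mult_distrib power_divide add.commute)
    finally show ?thesis using N0[of n] by (simp add: pos_divide_le_eq)
  qed
  \<comment> \<open>Writes a product of two standard deviations as the number of sites times
    standard deviations per square root of volume, each of which stays bounded.\<close>
  have sqrt_split: "sqrt x * sqrt y = r * (sqrt (x / r) * sqrt (y / r))" if "r > 0" for x y r :: real
    using that by (simp add: real_sqrt_divide)
  \<comment> \<open>\<open>\<gamma>\<close> is the constant of condition (I); the power of
    \<open>D / k\<close> bounds n^D by the number of sites of the cube. Neither depends on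
    \<open>A\<close>.\<close>
  define C where "C = sqrt (\<gamma> * (D / k) ^ CARD('d))"
  have "cmod (left_charge sc st Oloc om Q A) \<le> C * hil.sn A" if A: "A \<in> Ob" for A
  proof -
    let ?c = "\<lambda>n. centre (Q n)"
    let ?V = "\<lambda>n. Re (om (st (centre (blk (m n) A)) * centre (blk (m n) A)))"
    let ?M = "\<lambda>n. Max ((\<lambda>(x, y). cmod (?g A n x - ?g A n y)) ` (lball (k * real n) \<times> lball (k * real n)))"
    have bound: "cmod (om (st (?c n) * A)) \<le> ?M n + C * sqrt (?V n / ?N n)" if n: "n > 0" for n
    proof -
      \<comment> \<open>The left factor has mean zero, so the block sum can be centred at no cost;
        Cauchy-Schwarz then produces its variance.\<close>
      have "om (st (?c n) * centre (blk (m n) A)) = om (st (?c n) * blk (m n) A)"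
        by (simp only: centre_def[of "blk (m n) A"] right_diff_distrib om_diff sc_mult_right om_sc
            om_st_centre mult_1_right mult_zero_right diff_zero)
      also have "\<dots> = (\<Sum>x\<in>cube (m n). ?g A n x)"
        by (simp only: blk_def sum_distrib_left om_sum)
      finally have avg: "(\<Sum>x\<in>cube (m n). ?g A n x) = om (st (?c n) * centre (blk (m n) A))" ..
      have M: "cmod (?g A n 0 - ?g A n x) \<le> ?M n" if "x \<in> cube (m n)" for x
      proof (rule Max_ge)
        have "x \<in> lball (k * real n)"
          using that cube_subset_lball[of "m n" "k * real n"] m_le[of n] by (auto simp: D_def)
        moreover have "0 \<in> (lball (k * real n) :: (int ^ 'd) set)"
          using k by (simp add: lball_def ldist_def)
        ultimately show "cmod (?g A n 0 - ?g A n x)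
            \<in> (\<lambda>(x, y). cmod (?g A n x - ?g A n y)) ` (lball (k * real n) \<times> lball (k * real n))"
          by (intro image_eqI[of _ _ "(0, x)"]) auto
      qed (simp add: finite_lball)
      have "of_nat (card (cube (m n) :: (int ^ 'd) set)) * ?g A n 0
          = (\<Sum>x\<in>cube (m n). ?g A n 0 - ?g A n x) + (\<Sum>x\<in>cube (m n). ?g A n x)"
        by (simp add: sum_subtractf)
      moreover have "?N n * cmod (?g A n 0) = cmod (of_nat (card (cube (m n) :: (int ^ 'd) set)) * ?g A n 0)"
        by (simp only: norm_mult norm_of_nat)
      ultimately have "?N n * cmod (?g A n 0)
          \<le> cmod (\<Sum>x\<in>cube (m n). ?g A n 0 - ?g A n x) + cmod (\<Sum>x\<in>cube (m n). ?g A n x)"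
        by (simp only: norm_triangle_ineq)
      also have "cmod (\<Sum>x\<in>cube (m n). ?g A n 0 - ?g A n x) \<le> ?N n * ?M n"
        by (rule sum_norm_bound) (rule M)
      also have "cmod (\<Sum>x\<in>cube (m n). ?g A n x) \<le> gns.sn (?c n) * gns.sn (centre (blk (m n) A))"
        unfolding avg by (rule gns.Cauchy_Schwarz) auto
      also have "\<dots> \<le> sqrt (\<gamma> * real n ^ CARD('d)) * sqrt (?V n)"
        unfolding gns.sn_def by (intro mult_right_mono real_sqrt_le_mono \<gamma>(2) n) (auto simp: om_pos)
      also have "\<dots> = ?N n * (sqrt (\<gamma> * real n ^ CARD('d) / ?N n) * sqrt (?V n / ?N n))"
        by (rule sqrt_split[OF N0])
      also have "\<dots> \<le> ?N n * (C * sqrt (?V n / ?N n))"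
        unfolding C_def times_divide_eq_right[symmetric]
        by (intro mult_left_mono mult_right_mono real_sqrt_le_mono ratio real_sqrt_ge_zero
            divide_nonneg_nonneg om_pos of_nat_0_le_iff less_imp_le[OF \<gamma>(1)])
      finally have "?N n * cmod (?g A n 0) \<le> ?N n * (?M n + C * sqrt (?V n / ?N n))"
        by (simp only: distrib_left)
      then have "cmod (?g A n 0) \<le> ?M n + C * sqrt (?V n / ?N n)"
        by (rule mult_left_le_imp_le) (rule N0)
      then show ?thesis by (simp only: iota_0)
    qed
    have "(\<lambda>n. ?V n / ?N n) \<longlonglongrightarrow> Re (ipw st iota om A A)"
      by (rule filterlim_compose[OF blk_variance_density[OF A] m_lim])
    then have "(\<lambda>n. ?M n + C * sqrt (?V n / ?N n)) \<longlonglongrightarrow> 0 + C * sqrt (Re (ipw st iota om A A))"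
      by (intro tendsto_intros max0 A)
    then have "(\<lambda>n. ?M n + C * sqrt (?V n / ?N n)) \<longlonglongrightarrow> C * hil.sn A"
      by (simp add: hil.sn_def)
    then show ?thesis
    proof (rule LIMSEQ_le[OF tendsto_norm[OF left_charge_tendsto[OF P A]]], intro exI[of _ 1] allI impI)
      fix n :: nat assume "1 \<le> n"
      then have "n > 0" by simp
      then show "cmod (om (st (?c n) * A)) \<le> ?M n + C * sqrt (?V n / ?N n)" by (rule bound)
    qed
  qed
  then show ?thesis by blast
qed

end

section \<open>Every vector of the completion defines a pseudolocal charge\<close>

text \<open>\<open>J n\<close> is the largest j <= n for which \<open>P j n\<close> holds. Each
  fixed j is eventually a candidate, so \<open>J\<close> tends to infinity; for small n there may be
  no candidate, hence only an eventual conclusion.\<close>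

lemma diagonal_index:
  fixes P :: "nat \<Rightarrow> nat \<Rightarrow> bool"
  assumes ev: "\<And>j. \<forall>\<^sub>F n in sequentially. P j n"
  obtains J where "filterlim J sequentially sequentially" "\<forall>\<^sub>F n in sequentially. P (J n) n"
proof -
  define J where "J n = Max {j. j \<le> n \<and> P j n}" for n
  have fin: "finite {j. j \<le> n \<and> P j n}" for n by simp
  have ge: "\<forall>\<^sub>F n in sequentially. j \<le> J n \<and> P (J n) n" for j
    using ev[of j] eventually_ge_at_top[of j]
  proof eventually_elim
    case (elim n)
    then have j: "j \<in> {j. j \<le> n \<and> P j n}" by simp
    then show ?case using Max_ge[OF fin j] Max_in[OF fin, of n] unfolding J_def by blast
  qed
  show ?thesis
  proof
    show "filterlim J sequentially sequentially"
      unfolding filterlim_at_top by (intro allI eventually_mono[OF ge]) (rule conjunct1)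
    show "\<forall>\<^sub>F n in sequentially. P (J n) n" by (rule eventually_mono[OF ge]) (rule conjunct2)
  qed
qed

context clustering
begin

lemma blk_Oloc:
  assumes a: "a \<in> Oloc (lball (real R))" and n: "CARD('d) * m + R \<le> n"
  shows "blk m a \<in> Oloc (lball (real n))"
  unfolding blk_def
proof (rule Oloc_sum[OF finite_lball])
  fix x :: "int ^ 'd" assume x: "x \<in> cube m"
  have "(\<lambda>y. y + x) ` lball (real R) \<subseteq> lball (real n)"
  proof clarify
    fix y :: "int ^ 'd" assume y: "y \<in> lball (real R)"
    have "ldist (y + x) 0 \<le> ldist (y + x) x + ldist x 0" by (rule ldist_triangle)
    also have "ldist (y + x) x = ldist y 0" using ldist_translate[of y x 0] by simp
    also have "ldist y 0 + ldist x 0 \<le> int R + int (CARD('d) * m)"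
      using y ldist_cube_le[OF x] by (intro add_mono) (auto simp: lball_def)
    also have "\<dots> \<le> int n" using n by linarith
    finally show "y + x \<in> lball (real n)" by (simp add: lball_def)
  qed
  then show "iota x a \<in> Oloc (lball (real n))"
    using iota_Oloc[OF finite_lball a, of x] Oloc_mono[OF finite_imageI[OF finite_lball] finite_lball] by blast
qed

text \<open>The charge is realised by block sums \<open>\<Sum>\<^sub>x \<iota>\<^sub>x s\<^sub>j\<close> with \<open>j = J n\<close> growing so slowly that
  every estimate for the fixed observable \<open>s\<^sub>j\<close> already holds at size \<open>n\<close>. The blocks have half the
  admissible radius and the translations in condition (III) a quarter of it.\<close>

lemma charge_of_scauchy:
  assumes s: "hil.scauchy s"
  obtains Q where "pseudolocal sc st Oloc iota om Q"
    "\<And>A. A \<in> Ob \<Longrightarrow> left_charge sc st Oloc om Q A = lim (\<lambda>n. ipw st iota om (s n) A)"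
proof -
  have sO: "s j \<in> Ob" for j using s by (simp add: hil.scauchy_def)
  \<comment> \<open>The radius equals the index \<open>j\<close>: every fixed observable lies in the
    ball of radius \<open>J n\<close> once n is large, so these countably many constants suffice for
    all of them.\<close>
  have "\<forall>j. \<exists>K\<ge>0. \<forall>b\<in>Oloc (lball (real j)). \<forall>z. cmod (corr (s j) b z) \<le> K * norm b * wt decay z"
    using corr_bound_uniform[OF sO] by blast
  then obtain K where K: "\<And>j. K j \<ge> 0"
    "\<And>j b z. b \<in> Oloc (lball (real j)) \<Longrightarrow> cmod (corr (s j) b z) \<le> K j * norm b * wt decay z"
    by metis
  obtain R where R: "\<And>j. s j \<in> Oloc (lball (real (R j)))" 
  proof -
    have "\<forall>j. \<exists>R. s j \<in> Oloc (lball (real R))" using sO by (simp only: Obs_lball simp_thms)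
    then show ?thesis using that by metis
  qed
  obtain C where C: "C \<ge> 0" "\<And>n. hil.sn (s n) \<le> C" using hil.scauchy_bounded[OF s] by blast
  define D where "D = CARD('d)"
  have D: "D \<ge> 1" by (simp add: D_def Suc_le_eq)
  \<comment> \<open>With this choice \<open>cube (2 * h n)\<close> lies in the ball of radius n / 2,
    leaving n / 2 for the radius of \<open>s j\<close>, and translations from the ball of radius n /
    (4 D) lie in \<open>cube (h n)\<close>, at depth \<open>h n\<close> inside the block.\<close>
  define h where "h n = n div (4 * D)" for n
  let ?N = "\<lambda>n. real (card (cube (2 * h n) :: (int ^ 'd) set))"
  let ?V = "\<lambda>j n. Re (om (st (centre (blk (2 * h n) (s j))) * centre (blk (2 * h n) (s j))))"
  have h_le: "4 * D * h n \<le> n" for n by (simp add: h_def)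
  have h_lim: "filterlim h sequentially sequentially"
    unfolding filterlim_at_top eventually_sequentially
  proof (intro allI exI impI)
    fix Z n assume "Z * (4 * D) \<le> n"
    then show "Z \<le> h n" using D by (simp add: h_def less_eq_div_iff_mult_less_eq)
  qed
  have h2_lim: "filterlim (\<lambda>n. 2 * h n) sequentially sequentially"
    by (rule filterlim_at_top_mono[OF h_lim]) simp
  have lball_cube: "(lball (1 / real (4 * D) * real n) :: (int ^ 'd) set) \<subseteq> cube (h n)" for n
  proof
    fix x :: "int ^ 'd" assume "x \<in> lball (1 / real (4 * D) * real n)"
    then have "real_of_int (ldist x 0) * real (4 * D) \<le> real n"
      using D by (simp add: lball_def field_simps)
    then have "real_of_int (ldist x 0 * int (4 * D)) \<le> real_of_int (int n)" by simp
    then have "ldist x 0 * int (4 * D) \<le> int n" by (simp only: of_int_le_iff)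
    then have "ldist x 0 \<le> int n div int (4 * D)"
      using D zdiv_mono1[of "ldist x 0 * int (4 * D)" "int n" "int (4 * D)"] by simp
    then have "ldist x 0 \<le> int (h n)" by (simp add: h_def zdiv_int)
    then show "x \<in> cube (h n)" using abs_nth_le_ldist[of x] by (auto simp: cube_def intro: order_trans)
  qed
  \<comment> \<open>In turn: the block sum fits into the ball of radius n, its variance obeys (I)
    with room 1 above the limiting bound, and the window error is negligible, which serves (II) and
    (III).\<close>
  define P where "P j n \<longleftrightarrow> D * (2 * h n) + R j \<le> n \<and> ?V j n \<le> (C\<^sup>2 + 1) * ?N n
      \<and> K j * wt_tail TYPE('d) decay (h n) \<le> 1 / (real j + 1)" for j n
  have "\<forall>\<^sub>F n in sequentially. P j n" for j
  proof -
    have "\<forall>\<^sub>F n in sequentially. D * (2 * h n) + R j \<le> n"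
      using eventually_ge_at_top[of "2 * R j"]
    proof eventually_elim
      case (elim n)
      then show ?case using h_le[of n] by (simp add: mult.assoc)
    qed
    moreover have "\<forall>\<^sub>F n in sequentially. ?V j n \<le> (C\<^sup>2 + 1) * ?N n"
    proof -
      have "(\<lambda>n. ?V j n / ?N n) \<longlonglongrightarrow> Re (ipw st iota om (s j) (s j))"
        by (rule filterlim_compose[OF blk_variance_density[OF sO] h2_lim])
      moreover have "Re (ipw st iota om (s j) (s j)) < C\<^sup>2 + 1"
        using power_mono[OF C(2)[of j] hil.sn_nonneg[OF sO], of 2] by (simp add: hil.sn_sq[OF sO])
      ultimately have "\<forall>\<^sub>F n in sequentially. ?V j n / ?N n < C\<^sup>2 + 1" by (rule order_tendstoD(2))
      then show ?thesis
      proof eventually_elim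
        case (elim n)
        have "0 < ?N n" using card_cube_pos by simp
        then show ?case using elim by (simp only: pos_divide_less_eq less_imp_le)
      qed
    qed
    moreover have "\<forall>\<^sub>F n in sequentially. K j * wt_tail TYPE('d) decay (h n) \<le> 1 / (real j + 1)"
    proof -
      have "(\<lambda>n. K j * wt_tail TYPE('d) decay (h n)) \<longlonglongrightarrow> 0"
        by (intro tendsto_mult_right_zero filterlim_compose[OF wt_tail_tendsto[OF decay] h_lim])
      then have "\<forall>\<^sub>F n in sequentially. K j * wt_tail TYPE('d) decay (h n) < 1 / (real j + 1)"
        by (rule order_tendstoD(2)) simp
      then show ?thesis by eventually_elim simp
    qed
    ultimately show ?thesis unfolding P_def by eventually_elim blast
  qed
  then obtain J where J_lim: "filterlim J sequentially sequentially"
    and J_ev: "\<forall>\<^sub>F n in sequentially. P (J n) n" by (rule diagonal_index)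
  \<comment> \<open>The default 0 keeps locality and the variance bound valid for every n, not only
    eventually.\<close>
  define Q where "Q n = (if P (J n) n then blk (2 * h n) (s (J n)) else 0)" for n
  have centre_zero: "centre 0 = 0" by (simp add: centre_def om_zero)

  \<comment> \<open>Uniformity in \<open>y\<close> lets one estimate serve twice: y = 0 gives the
    limit in (II), two values of y give (III).\<close>
  have approx: "\<forall>\<^sub>F n in sequentially. \<forall>y\<in>lball (1 / real (4 * D) * real n).
      cmod (om (st (centre (Q n)) * iota y A) - ipw st iota om (s (J n)) A) \<le> norm A / (real (J n) + 1)"
    if A: "A \<in> Ob" for A
  proof -
    obtain RA where RA: "A \<in> Oloc (lball (real RA))" using A Obs_lball by blast
    have "\<forall>\<^sub>F n in sequentially. RA \<le> J n" using J_lim by (simp add: filterlim_at_top)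
    with J_ev show ?thesis
    proof eventually_elim
      case (elim n)
      have "A \<in> Oloc (lball (real (J n)))"
        using RA Oloc_mono[OF finite_lball finite_lball lball_mono] elim(2) by (meson of_nat_le_iff subsetD)
      note bnd = K(2)[OF this]
      have "cmod (om (st (centre (Q n)) * iota y A) - ipw st iota om (s (J n)) A)
          \<le> K (J n) * norm A * wt_tail TYPE('d) decay (h n)"
        if "y \<in> lball (1 / real (4 * D) * real n)" for y
        using window_sum_close[OF decay bnd, of y "h n" "h n" "2 * h n"] that lball_cube[of n] elim(1)
        by (auto simp: Q_def blk_covariance ipw_eq_infsum mult_2)
      also have "K (J n) * norm A * wt_tail TYPE('d) decay (h n) \<le> norm A / (real (J n) + 1)"
        using mult_left_mono[of "K (J n) * wt_tail TYPE('d) decay (h n)" "1 / (real (J n) + 1)" "norm A"] elim(1)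
        by (simp add: P_def mult.assoc mult.left_commute)
      finally show ?case by blast
    qed
  qed
  have J_real: "filterlim (\<lambda>n. real (J n) + 1) at_infinity sequentially"
    by (intro filterlim_at_top_imp_at_infinity filterlim_at_top_mono[OF filterlim_compose[OF filterlim_real_sequentially J_lim]])
      simp
  have err: "(\<lambda>n. c / (real (J n) + 1)) \<longlonglongrightarrow> 0" for c :: real
    by (rule tendsto_divide_0[OF tendsto_const J_real])
  have ball0: "0 \<in> (lball (1 / real (4 * D) * real n) :: (int ^ 'd) set)" for n
    by (simp add: lball_def ldist_def)
  have limit: "(\<lambda>n. om (st (centre (Q n)) * A)) \<longlonglongrightarrow> lim (\<lambda>n. ipw st iota om (s n) A)"
    if A: "A \<in> Ob" for A
  proof -
    have "(\<lambda>n. ipw st iota om (s n) A) \<longlonglongrightarrow> lim (\<lambda>n. ipw st iota om (s n) A)"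
      using hil.scauchy_convergent_F[OF s A] by (simp add: convergent_LIMSEQ_iff)
    then have L: "(\<lambda>n. ipw st iota om (s (J n)) A) \<longlonglongrightarrow> lim (\<lambda>n. ipw st iota om (s n) A)"
      by (rule filterlim_compose[OF _ J_lim])
    have "(\<lambda>n. om (st (centre (Q n)) * A) - ipw st iota om (s (J n)) A) \<longlonglongrightarrow> 0"
    proof (rule Lim_null_comparison[OF _ err[of "norm A"]])
      show "\<forall>\<^sub>F n in sequentially. norm (om (st (centre (Q n)) * A) - ipw st iota om (s (J n)) A)
          \<le> norm A / (real (J n) + 1)"
        using approx[OF A] by eventually_elim (use ball0 iota_0 in metis)
    qed
    from tendsto_add[OF this L] show ?thesis by simp
  qed
  have "pseudolocal sc st Oloc iota om Q"
    unfolding pseudolocal_def centred_eq_centre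
  proof (intro conjI allI ballI)
    show "Q n \<in> Oloc (lball (real n))" for n
      using blk_Oloc[OF R, of "2 * h n" "J n" n]
      by (auto simp: Q_def P_def D_def Oloc_zero[OF finite_lball])
    show "\<exists>\<gamma>>0. \<forall>n>0. Re (om (st (centre (Q n)) * centre (Q n))) \<le> \<gamma> * real n ^ CARD('d)"
    proof (intro exI[of _ "(C\<^sup>2 + 1) * 2 ^ CARD('d)"] conjI allI impI)
      fix n :: nat assume n: "n > 0"
      show "Re (om (st (centre (Q n)) * centre (Q n))) \<le> (C\<^sup>2 + 1) * 2 ^ CARD('d) * real n ^ CARD('d)"
      proof (cases "P (J n) n")
        case True
        have "4 * h n \<le> 4 * D * h n" using D by simp
        \<comment> \<open>The side of the cube is at most 2n because n >= 1; this is the origin of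
          the factor \<open>2 ^ CARD('d)\<close>.\<close>
        then have "2 * (2 * h n) + 1 \<le> 2 * n" using h_le[of n] n by linarith
        then have "card (cube (2 * h n) :: (int ^ 'd) set) \<le> (2 * n) ^ CARD('d)"
          unfolding card_cube by (intro power_mono) auto
        then have "?N n \<le> 2 ^ CARD('d) * real n ^ CARD('d)"
          unfolding of_nat_le_iff[where ?'a = real, symmetric] by (simp add: power_mult_distrib)
        then have "(C\<^sup>2 + 1) * ?N n \<le> (C\<^sup>2 + 1) * (2 ^ CARD('d) * real n ^ CARD('d))"
          by (intro mult_left_mono) auto
        then show ?thesis using True by (simp add: Q_def P_def mult.assoc)
      qed (simp add: Q_def centre_zero om_zero)
    qed (simp add: add_nonneg_pos)
    show "convergent (\<lambda>n. om (st (centre (Q n)) * A))" if "A \<in> Ob" for A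
      using limit[OF that] by (auto simp: convergent_def)
    show "\<exists>k. 0 < k \<and> k < 1 \<and> (\<forall>A\<in>Ob.
        (\<lambda>n. Max ((\<lambda>(x, y). cmod (om (st (centre (Q n)) * iota x A) - om (st (centre (Q n)) * iota y A)))
                 ` (lball (k * real n) \<times> lball (k * real n)))) \<longlonglongrightarrow> 0)"
    proof (intro exI[of _ "1 / real (4 * D)"] conjI ballI)
      fix A assume A: "A \<in> Ob"
      let ?B = "\<lambda>n. lball (1 / real (4 * D) * real n) :: (int ^ 'd) set"
      let ?f = "\<lambda>n. \<lambda>(x, y). cmod (om (st (centre (Q n)) * iota x A) - om (st (centre (Q n)) * iota y A))"
      have fin: "finite (?f n ` (?B n \<times> ?B n))" for n by (intro finite_imageI finite_cartesian_product finite_lball)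
      have "(\<lambda>n. Max (?f n ` (?B n \<times> ?B n))) \<longlonglongrightarrow> 0"
      proof (rule real_tendsto_sandwich[OF _ _ tendsto_const err[of "2 * norm A"]])
        show "\<forall>\<^sub>F n in sequentially. 0 \<le> Max (?f n ` (?B n \<times> ?B n))"
        proof (intro always_eventually allI)
          fix n
          have "?f n (0, 0) \<le> Max (?f n ` (?B n \<times> ?B n))"
            using ball0 by (intro Max_ge fin imageI) blast
          then show "0 \<le> Max (?f n ` (?B n \<times> ?B n))" by simp
        qed
        show "\<forall>\<^sub>F n in sequentially. Max (?f n ` (?B n \<times> ?B n)) \<le> 2 * norm A / (real (J n) + 1)"
          using approx[OF A]
        proof eventually_elim
          case (elim n)
          show ?case
          proof (rule Max.boundedI[OF fin])
            show "?f n ` (?B n \<times> ?B n) \<noteq> {}" using ball0 by blast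
            fix v assume "v \<in> ?f n ` (?B n \<times> ?B n)"
            then obtain x y where xy: "x \<in> ?B n" "y \<in> ?B n"
              and v: "v = cmod (om (st (centre (Q n)) * iota x A) - om (st (centre (Q n)) * iota y A))"
              by auto
            have "v \<le> cmod (om (st (centre (Q n)) * iota x A) - ipw st iota om (s (J n)) A)
                + cmod (om (st (centre (Q n)) * iota y A) - ipw st iota om (s (J n)) A)"
              unfolding v by (rule norm_diff_triangle_le[OF order_refl])
                (simp only: norm_minus_commute order_refl)
            also have "\<dots> \<le> norm A / (real (J n) + 1) + norm A / (real (J n) + 1)"
              using elim xy by (intro add_mono) auto
            finally show "v \<le> 2 * norm A / (real (J n) + 1)" by simp
          qed
        qed
      qed
      then show "(\<lambda>n. Max (?f n ` (?B n \<times> ?B n))) \<longlonglongrightarrow> 0" .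
    qed (use D in auto)
  qed
  moreover have "left_charge sc st Oloc om Q A = lim (\<lambda>n. ipw st iota om (s n) A)" if "A \<in> Ob" for A
    using limit[OF that] that by (simp add: left_charge_def centred_eq_centre limI)
  ultimately show ?thesis using that by blast
qed

section \<open>The bijection between vectors and charges\<close>

abbreviation H :: "(nat \<Rightarrow> 'a) set set" where "H \<equiv> Hspace Oloc st iota om"

abbreviation rel :: "((nat \<Rightarrow> 'a) \<times> (nat \<Rightarrow> 'a)) set" where "rel \<equiv> hrel Oloc st iota om"

lemma H_class: "hil.scauchy s \<Longrightarrow> rel `` {s} \<in> H"
  by (simp add: Hspace_def quotientI hcauchy_eq)

text \<open>\<open>Hip\<close> evaluates an arbitrary representative; the chosen one is Cauchy and
  spans the same class.\<close>

lemma H_representative: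
  assumes "h \<in> H" obtains t where "t = (SOME s. s \<in> h)" "hil.scauchy t" "h = rel `` {t}"
proof -
  define t where "t = (SOME s. s \<in> h)"
  obtain s where s: "hcauchy Oloc st iota om s" "h = rel `` {s}"
    using assms by (auto simp: Hspace_def elim: quotientE)
  have "s \<in> h" using equiv_class_self[OF equiv_hrel] s by simp
  then have "t \<in> h" unfolding t_def by (rule someI[of "\<lambda>s. s \<in> h"])
  then have st: "(s, t) \<in> rel" using s by simp
  then have "hil.scauchy t" by (simp add: hrel_eq)
  moreover have "h = rel `` {t}" using equiv_class_eq[OF equiv_hrel st] s by simp
  ultimately show ?thesis using that t_def by blast
qed

text \<open>Cauchy-Schwarz for the difference of the sequences; hence \<open>Hip\<close> does not
  depend on the representative chosen.\<close>

lemma hrel_same_limit: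
  assumes r: "(s, t) \<in> rel" and A: "A \<in> Ob" and l: "(\<lambda>n. ipw st iota om (s n) A) \<longlonglongrightarrow> l"
  shows "(\<lambda>n. ipw st iota om (t n) A) \<longlonglongrightarrow> l"
proof -
  have S: "s n \<in> Ob" "t n \<in> Ob" for n using r by (auto simp: hrel_eq hil.scauchy_def)
  have "(\<lambda>n. hil.sn (s n - t n) * hil.sn A) \<longlonglongrightarrow> 0"
    using r by (intro tendsto_mult_left_zero) (simp add: hrel_eq)
  then have "(\<lambda>n. ipw st iota om (s n) A - ipw st iota om (t n) A) \<longlonglongrightarrow> 0"
  proof (rule Lim_null_comparison[rotated], intro always_eventually allI)
    show "norm (ipw st iota om (s n) A - ipw st iota om (t n) A) \<le> hil.sn (s n - t n) * hil.sn A" for n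
      using hil.Cauchy_Schwarz[of "s n - t n" A] S A by (simp add: hil.F_diff_left hil.S_diff)
  qed
  from tendsto_diff[OF l this] show ?thesis by simp
qed

text \<open>The inverse of the required map. The value 0 off the local observables matches the
  convention in \<open>left_charge\<close>, so equality of functionals tests local observables
  only.\<close>

definition charge_of :: "(nat \<Rightarrow> 'a) set \<Rightarrow> 'a \<Rightarrow> complex" where
  "charge_of h A = (if A \<in> Ob then Hip st iota om h A else 0)"

lemma Hip_class:
  assumes s: "hil.scauchy s" and A: "A \<in> Ob"
  shows "(\<lambda>n. ipw st iota om (s n) A) \<longlonglongrightarrow> Hip st iota om (rel `` {s}) A"
proof -
  obtain t where t: "t = (SOME u. u \<in> rel `` {s})" "hil.scauchy t" "rel `` {s} = rel `` {t}"
    using H_representative[OF H_class[OF s]] by blast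
  have "(t, s) \<in> rel"
    using eq_equiv_class[OF t(3)[symmetric] equiv_hrel] s by (simp add: hcauchy_eq)
  moreover have "(\<lambda>n. ipw st iota om (t n) A) \<longlonglongrightarrow> Hip st iota om (rel `` {s}) A"
    using hil.scauchy_convergent_F[OF t(2) A] by (simp add: Hip_def t(1) convergent_LIMSEQ_iff)
  ultimately show ?thesis using A hrel_same_limit by blast
qed

text \<open>Representatives of two vectors with the same charge differ by a Cauchy sequence that is
  weakly null, hence null in seminorm.\<close>

lemma inj_charge_of: "inj_on charge_of H"
proof (rule inj_onI)
  fix h h' assume h: "h \<in> H" "h' \<in> H" and eq: "charge_of h = charge_of h'"
  obtain s t where s: "hil.scauchy s" "h = rel `` {s}" and t: "hil.scauchy t" "h' = rel `` {t}"
    using H_representative h by metis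
  have S: "s n \<in> Ob" "t n \<in> Ob" for n using s t by (auto simp: hil.scauchy_def)
  have "hil.scauchy (\<lambda>n. s n - t n)"
    unfolding hil.scauchy_def
  proof (intro conjI allI impI hil.S_diff S)
    fix e :: real assume "e > 0"
    then have "e / 2 > 0" by simp
    then obtain N1 N2 where N1: "\<And>m n. m \<ge> N1 \<Longrightarrow> n \<ge> N1 \<Longrightarrow> hil.sn (s m - s n) < e / 2"
      and N2: "\<And>m n. m \<ge> N2 \<Longrightarrow> n \<ge> N2 \<Longrightarrow> hil.sn (t m - t n) < e / 2"
      using s(1) t(1) unfolding hil.scauchy_def by meson
    have "hil.sn (s m - t m - (s n - t n)) < e" if "m \<ge> max N1 N2" "n \<ge> max N1 N2" for m n
    proof -
      have split: "s m - t m - (s n - t n) = (s m - s n) + (t n - t m)" by simp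
      have "hil.sn (s m - t m - (s n - t n)) \<le> hil.sn (s m - s n) + hil.sn (t n - t m)"
        unfolding split by (intro hil.sn_triangle hil.S_diff S)
      also have "\<dots> < e / 2 + e / 2" using that by (intro add_strict_mono N1 N2) auto
      finally show ?thesis by simp
    qed
    then show "\<exists>N. \<forall>m\<ge>N. \<forall>n\<ge>N. hil.sn (s m - t m - (s n - t n)) < e" by blast
  qed
  moreover have "(\<lambda>n. ipw st iota om (s n - t n) A) \<longlonglongrightarrow> 0" if A: "A \<in> Ob" for A
  proof -
    have "Hip st iota om h A = Hip st iota om h' A"
      using fun_cong[OF eq, of A] A by (simp add: charge_of_def)
    then show ?thesis
      using tendsto_diff[OF Hip_class[OF s(1) A] Hip_class[OF t(1) A]]
      by (simp add: s(2) t(2) hil.F_diff_left S A)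
  qed
  ultimately have "(\<lambda>n. hil.sn (s n - t n)) \<longlonglongrightarrow> 0" by (rule hil.scauchy_weakly_null)
  then have "(s, t) \<in> rel" using s t by (simp add: hrel_eq)
  then show "h = h'" using equiv_class_eq[OF equiv_hrel] s t by simp
qed

text \<open>Block sums of a representative give one inclusion; boundedness of charges together with
  Riesz representation gives the other.\<close>

lemma charge_of_image: "charge_of ` H = charges sc st Oloc iota om"
proof (intro equalityI subsetI)
  fix q assume "q \<in> charge_of ` H"
  then obtain h where h: "h \<in> H" "q = charge_of h" by blast
  obtain s where s: "hil.scauchy s" "h = rel `` {s}" using H_representative[OF h(1)] by blast
  obtain Q where Q: "pseudolocal sc st Oloc iota om Q"
    "\<And>A. A \<in> Ob \<Longrightarrow> left_charge sc st Oloc om Q A = lim (\<lambda>n. ipw st iota om (s n) A)"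
    using charge_of_scauchy[OF s(1)] by blast
  have "q = left_charge sc st Oloc om Q"
  proof
    fix A
    show "q A = left_charge sc st Oloc om Q A"
    proof (cases "A \<in> Ob")
      case True
      then show ?thesis
        using limI[OF Hip_class[OF s(1) True]] Q(2) by (simp add: h(2) charge_of_def s(2))
    next
      case False
      then show ?thesis by (simp add: h(2) charge_of_def left_charge_def)
    qed
  qed
  then show "q \<in> charges sc st Oloc iota om" using Q(1) by (auto simp: charges_def)
next
  fix q assume "q \<in> charges sc st Oloc iota om"
  then obtain Q where Q: "pseudolocal sc st Oloc iota om Q" "q = left_charge sc st Oloc om Q"
    by (auto simp: charges_def)
  obtain C where "\<And>A. A \<in> Ob \<Longrightarrow> cmod (q A) \<le> C * hil.sn A"
    using left_charge_bounded[OF Q(1)] Q(2) by blast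
  moreover have "q (A + B) = q A + q B" if "A \<in> Ob" "B \<in> Ob" for A B
    using left_charge_add[OF Q(1) that] Q(2) by simp
  moreover have "q (sc c A) = c * q A" if "A \<in> Ob" for c A
    using left_charge_sc[OF Q(1) that] Q(2) by simp
  ultimately obtain s where s: "hil.scauchy s" "\<And>A. A \<in> Ob \<Longrightarrow> (\<lambda>n. ipw st iota om (s n) A) \<longlonglongrightarrow> q A"
    using hil.Riesz_representation[of q C] by blast
  have "charge_of (rel `` {s}) = q"
  proof
    fix A
    show "charge_of (rel `` {s}) A = q A"
    proof (cases "A \<in> Ob")
      case True
      then show ?thesis using LIMSEQ_unique[OF Hip_class[OF s(1) True] s(2)] by (simp add: charge_of_def)
    next
      case False
      then show ?thesis by (simp add: charge_of_def Q(2) left_charge_def)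
    qed
  qed
  then show "q \<in> charge_of ` H" using H_class[OF s(1)] by blast
qed

end

theorem theorem5p3:
  fixes sc :: "complex \<Rightarrow> 'a::{real_normed_algebra_1,banach} \<Rightarrow> 'a"
    and st :: "'a \<Rightarrow> 'a"
    and Oloc :: "(int ^ 'd) set \<Rightarrow> 'a set"
    and iota :: "int ^ 'd \<Rightarrow> 'a \<Rightarrow> 'a"
    and om :: "'a \<Rightarrow> complex"
  assumes "quasi_local sc st Oloc iota"
    and "clustering_state sc st Oloc iota om"
  shows "\<exists>\<DD>. bij_betw \<DD> (charges sc st Oloc iota om) (Hspace Oloc st iota om)
            \<and> (\<forall>q\<in>charges sc st Oloc iota om. \<forall>A\<in>Obs Oloc. q A = Hip st iota om (\<DD> q) A)
            \<and> (\<forall>q\<in>charges sc st Oloc iota om. \<exists>C. \<forall>A\<in>Obs Oloc.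
                  cmod (q A) \<le> C * sqrt (cmod (ipw st iota om A A)))"
proof -
  interpret clustering sc st Oloc iota om
    using assms by unfold_locales
  have bij: "bij_betw charge_of (Hspace Oloc st iota om) (charges sc st Oloc iota om)"
    using inj_charge_of charge_of_image by (simp add: bij_betw_def)
  let ?D = "inv_into (Hspace Oloc st iota om) charge_of"
  show ?thesis
  proof (intro exI[of _ ?D] conjI ballI)
    show "bij_betw ?D (charges sc st Oloc iota om) (Hspace Oloc st iota om)"
      by (rule bij_betw_inv_into[OF bij])
  next
    fix q A assume q: "q \<in> charges sc st Oloc iota om" and A: "A \<in> Obs Oloc"
    have "charge_of (?D q) = q" using bij_betw_inv_into_right[OF bij q] .
    then show "q A = Hip st iota om (?D q) A" using A by (metis charge_of_def)
  next
    fix q assume "q \<in> charges sc st Oloc iota om"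
    then obtain Q where Q: "pseudolocal sc st Oloc iota om Q" "q = left_charge sc st Oloc om Q"
      by (auto simp: charges_def)
    have "hil.sn A = sqrt (cmod (ipw st iota om A A))" if "A \<in> Obs Oloc" for A
      using that by (simp add: hil.sn_def hil.cmod_F_self)
    then show "\<exists>C. \<forall>A\<in>Obs Oloc. cmod (q A) \<le> C * sqrt (cmod (ipw st iota om A A))"
      using left_charge_bounded[OF Q(1)] Q(2) by simp
  qed
qed

end
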